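(* Let $\Gamma$ be a finite group of order $k\ge 2$, let $d\ge 1$ be an integer, and let $D$ be a $d$-regular digraph with an edge-labelling $w:E(D)\to\Gamma$. Then $D$ has a directed cycle cover containing at least $\left\lfloor \dfrac{d}{25k}\right\rfloor$ zero-sum cycles.
   Context: All digraphs are finite, nonempty, simple and loopless: for each ordered pair $(u,v)$ there is at most one edge from $u$ to $v$, there are no edges from a vertex to itself, and both opposite edges $uv$ and $vu$ may be present. A digraph is $d$-regular if every vertex has outdegree $d$ and indegree $d$. A directed cycle $C=v_1v_2\cdots v_\ell v_1$ has distinct vertices $v_1,\dots,v_\ell$ and all displayed edges in $D$ (so $\ell\ge 2$); cycles differing by cyclic rotation are the same. A directed cycle cover of $D$ is a collection of pairwise vertex-disjoint directed cycles (of length at least two) that covers every vertex of $D$. $\Gamma$ is written multiplicatively with identity $1_\Gamma$ and need not be abelian. The ordered label product of $C$ is $w(C)=w(v_1v_2)w(v_2v_3)\cdots w(v_\ell v_1)$; $C$ is zero-sum if $w(C)=1_\Gamma$ (independent of the choice of initial vertex). *)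

theory Defs
  imports Complex_Main "HOL-Algebra.Coset" "Graph_Theory.Digraph" "Graph_Theory.Arc_Walk"
begin

text \<open>
  The locale \<open>digraph\<close> is a finite digraph without loops and without parallel arcs; opposite
  arcs are allowed, and so is the null graph, which has to be excluded separately.
\<close>

definition regular_digraph :: "nat \<Rightarrow> ('a, 'b) pre_digraph \<Rightarrow> bool" where
  "regular_digraph d D \<longleftrightarrow> (\<forall>v\<in>verts D. out_degree D v = d \<and> in_degree D v = d)"

text \<open>
  A directed cycle is given by its list of arcs from some initial vertex
  (\<open>pre_digraph.cycle\<close>); in a loop-free digraph such a list has length at least two
  (\<open>loopfree_digraph.cycle_digraph_conv\<close>).  Every vertex of a cycle is the tail of
  exactly one of its arcs.
\<close>

definition cycle_verts :: "('a, 'b) pre_digraph \<Rightarrow> 'b list \<Rightarrow> 'a set" where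
  "cycle_verts D p = tail D ` set p"

text \<open>
  Disjointness is required of any two different arc lists.  Two rotations of one cycle share
  their vertices, so a cover contains at most one list for each cycle, and its cardinality
  counts cycles up to rotation.
\<close>

definition directed_cycle_cover :: "('a, 'b) pre_digraph \<Rightarrow> 'b list set \<Rightarrow> bool" where
  "directed_cycle_cover D C \<longleftrightarrow>
     (\<forall>p\<in>C. pre_digraph.cycle D p) \<and>
     pairwise (\<lambda>p q. disjnt (cycle_verts D p) (cycle_verts D q)) C \<and>
     (\<Union>p\<in>C. cycle_verts D p) = verts D"

definition label_product :: "('g, 'm) monoid_scheme \<Rightarrow> ('b \<Rightarrow> 'g) \<Rightarrow> 'b list \<Rightarrow> 'g" where
  "label_product \<Gamma> w p = foldr (\<lambda>e x. w e \<otimes>\<^bsub>\<Gamma>\<^esub> x) p \<one>\<^bsub>\<Gamma>\<^esub>"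

definition zero_sum :: "('g, 'm) monoid_scheme \<Rightarrow> ('b \<Rightarrow> 'g) \<Rightarrow> 'b list \<Rightarrow> bool" where
  "zero_sum \<Gamma> w p \<longleftrightarrow> label_product \<Gamma> w p = \<one>\<^bsub>\<Gamma>\<^esub>"

lemma (in monoid) label_product_closed:
  "w ` set p \<subseteq> carrier G \<Longrightarrow> label_product G w p \<in> carrier G"
  by (induction p) (auto simp: label_product_def)

lemma (in monoid) label_product_append:
  "w ` set p \<subseteq> carrier G \<Longrightarrow> w ` set q \<subseteq> carrier G \<Longrightarrow>
     label_product G w (p @ q) = label_product G w p \<otimes> label_product G w q"
proof (induction p)
  case Nil
  then show ?case using label_product_closed[of w q] by (simp add: label_product_def)
next
  case (Cons e p)
  then show ?case using label_product_closed[of w p] label_product_closed[of w q]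
    by (simp add: label_product_def m_assoc)
qed

text \<open>Being zero-sum does not depend on the initial vertex.\<close>

lemma (in group) zero_sum_rotate:
  assumes "w ` set p \<subseteq> carrier G"
  shows "zero_sum G w (rotate n p) \<longleftrightarrow> zero_sum G w p"
proof -
  define a b where "a = take (n mod length p) p" and "b = drop (n mod length p) p"
  have p: "p = a @ b" and r: "rotate n p = b @ a"
    by (simp_all add: a_def b_def rotate_drop_take)
  have ab: "w ` set a \<subseteq> carrier G" "w ` set b \<subseteq> carrier G"
    using assms unfolding p by auto
  show ?thesis
    unfolding r unfolding p zero_sum_def label_product_append[OF ab]
      label_product_append[OF ab(2,1)]
    using label_product_closed[OF ab(1)] label_product_closed[OF ab(2)] inv_comm by blast
qed

end

theory Submission
  imports Defs "Jordan_Normal_Form.Schur_Decomposition" "HOL-Combinatorics.Cycles"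
    "HOL-Analysis.Analysis"
begin

text \<open>
  Choose a cycle cover for every permutation \<open>\<sigma>\<close> of the vertices along arcs, let \<open>T \<sigma>\<close> be its
  number of zero-sum cycles, and let \<open>q y\<close> be the sum of \<open>y ^ T \<sigma>\<close> over all such \<open>\<sigma>\<close>.  Then
  \<open>q 1\<close> is the permanent of the adjacency matrix, at least \<open>(d / e) ^ n\<close> by Gurvits' capacity
  argument.  At \<open>y = 1 - k j\<close> the weight \<open>y\<close> of a zero-sum cycle and \<open>1\<close> of any other one are minus
  the character of \<open>j\<close> copies of the regular representation with one trivial summand removed,
  so \<open>\<bar>q y\<bar>\<close> is a sum of principal minors of a block matrix \<open>A\<close>.  This sum is the multilinear
  coefficient of \<open>det (1 + Z A)\<close>, hence by Cauchy's estimate and Hadamard's inequality at most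
  \<open>(e d k j) powr (n / 2)\<close>.  If every \<open>T \<sigma>\<close> were less than \<open>m = \<lfloor>d / (25 k)\<rfloor>\<close>, the \<open>m\<close>-th
  difference of \<open>q\<close> along \<open>1, 1 - k, \<dots>, 1 - k m\<close> would vanish, giving
  \<open>(d / e) ^ n \<le> 2 ^ m * (e d\<^sup>2 / 25) powr (n / 2)\<close>, which is false because \<open>n \<ge> d \<ge> 50 m\<close>
  and \<open>25 / e ^ 3 > 1.2\<close>.
\<close>

hide_const (open) Polynomial.order

section \<open>A lower bound for the permanent\<close>

text \<open>For finite \<open>R\<close> and \<open>J\<close> this is the coefficient of the product
  of all variables \<open>t j\<close> in the product, over \<open>i\<close> in \<open>R\<close>, of
  \<open>z i\<close> plus the sum of \<open>t j * a j i\<close> over \<open>J\<close>. It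
  interpolates between a product of linear forms at \<open>J = {}\<close> and a permanent at
  \<open>card J = card R\<close>.\<close>

definition mixed_perm :: "('a \<Rightarrow> 'b \<Rightarrow> real) \<Rightarrow> 'b set \<Rightarrow> 'a set \<Rightarrow> ('b \<Rightarrow> real) \<Rightarrow> real" where
  "mixed_perm a R J z =
     (\<Sum>f | f \<in> J \<rightarrow>\<^sub>E R \<and> inj_on f J. (\<Prod>j\<in>J. a j (f j)) * (\<Prod>i\<in>R - f ` J. z i))"

lemma mixed_perm_empty [simp]: "mixed_perm a R {} z = (\<Prod>i\<in>R. z i)"
  by (simp add: mixed_perm_def)

text \<open>Column expansion: an injection on \<open>insert j J\<close> amounts to a row
  \<open>i\<close> for \<open>j\<close> and an injection of \<open>J\<close> avoiding
  \<open>i\<close>. Resetting the value at \<open>j\<close> to \<open>undefined\<close> makes the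
  latter extensional on \<open>J\<close>.\<close>

lemma mixed_perm_insert:
  assumes fin: "finite R" "finite J" and j: "j \<notin> J"
  shows "mixed_perm a R (insert j J) z = (\<Sum>i\<in>R. a j i * mixed_perm a (R - {i}) J z)"
proof -
  let ?F = "\<lambda>R J. {f. f \<in> J \<rightarrow>\<^sub>E R \<and> inj_on f J}"
  have finF: "finite (?F (R - {i}) J)" for i
    using fin by (auto intro: finite_subset[OF _ finite_PiE[of J "\<lambda>_. R - {i}"]])
  have "(\<Sum>i\<in>R. a j i * mixed_perm a (R - {i}) J z) =
      (\<Sum>(i, f)\<in>(SIGMA i:R. ?F (R - {i}) J).
         a j i * ((\<Prod>j\<in>J. a j (f j)) * (\<Prod>i\<in>R - {i} - f ` J. z i)))"
    using fin finF by (simp add: mixed_perm_def sum_distrib_left sum.Sigma)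
  also have "\<dots> = mixed_perm a R (insert j J) z"
    unfolding mixed_perm_def
  proof (rule sum.reindex_bij_witness[where i = "\<lambda>f. (f j, f(j := undefined))"
        and j = "\<lambda>(i, f). f(j := i)"])
    fix p assume p: "p \<in> (SIGMA i:R. ?F (R - {i}) J)"
    obtain i f where [simp]: "p = (i, f)" by (cases p)
    have i: "i \<in> R" and f: "f \<in> J \<rightarrow>\<^sub>E R - {i}" and inj: "inj_on f J" using p by auto
    have fj: "f j = undefined" using f j by (auto simp: PiE_def extensional_def)
    show "(\<lambda>f. (f j, f(j := undefined))) (case p of (i, f) \<Rightarrow> f(j := i)) = p"
      using fj by (auto simp: fun_eq_iff)
    have im: "(f(j := i)) ` J = f ` J" using j by auto
    have PiE: "f(j := i) \<in> insert j J \<rightarrow>\<^sub>E R"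
      using f i by (auto simp: PiE_def extensional_def Pi_def)
    moreover have "inj_on (f(j := i)) (insert j J)"
      using f inj j by (auto simp: inj_on_def PiE_def Pi_def)
    ultimately show "(case p of (i, f) \<Rightarrow> f(j := i)) \<in> {f \<in> insert j J \<rightarrow>\<^sub>E R. inj_on f (insert j J)}"
      by simp
    have "(\<Prod>x\<in>J. a x ((f(j := i)) x)) = (\<Prod>x\<in>J. a x (f x))"
      using j by (intro prod.cong) auto
    moreover have "R - (f(j := i)) ` insert j J = R - {i} - f ` J"
      using im by auto
    ultimately show "(\<Prod>x\<in>insert j J. a x ((case p of (i, f) \<Rightarrow> f(j := i)) x)) *
        prod z (R - (case p of (i, f) \<Rightarrow> f(j := i)) ` insert j J) =
        (case p of (i, f) \<Rightarrow> a j i * ((\<Prod>j\<in>J. a j (f j)) * prod z (R - {i} - f ` J)))"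
      using fin j by (simp add: mult.assoc)
  next
    fix f assume f: "f \<in> {f \<in> insert j J \<rightarrow>\<^sub>E R. inj_on f (insert j J)}"
    show "(case (f j, f(j := undefined)) of (i, f) \<Rightarrow> f(j := i)) = f" by simp
    show "(f j, f(j := undefined)) \<in> (SIGMA i:R. ?F (R - {i}) J)"
      using f j by (auto simp: PiE_def extensional_def Pi_def inj_on_def)
  qed
  finally show ?thesis by simp
qed

text \<open>Row expansion: row \<open>i\<close> is either uncovered, giving the factor
  \<open>z i\<close>, or the image of exactly one \<open>j\<close>. The induction uses that column
  expansion commutes with removing a row.\<close>

lemma mixed_perm_row:
  assumes "finite R" "finite J" and "i \<in> R"
  shows "mixed_perm a R J z =
    z i * mixed_perm a (R - {i}) J z + (\<Sum>j\<in>J. a j i * mixed_perm a (R - {i}) (J - {j}) z)"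
  using assms(2,1,3)
proof (induction J arbitrary: R rule: finite_induct)
  case empty
  then show ?case by (simp add: prod.remove)
next
  case (insert j J)
  have sw: "R - {i'} - {i} = R - {i} - {i'}" for i' by auto
  have "mixed_perm a R (insert j J) z =
      a j i * mixed_perm a (R - {i}) J z + (\<Sum>i'\<in>R - {i}. a j i' * mixed_perm a (R - {i'}) J z)"
    using insert by (simp add: mixed_perm_insert sum.remove)
  also have "(\<Sum>i'\<in>R - {i}. a j i' * mixed_perm a (R - {i'}) J z) =
      (\<Sum>i'\<in>R - {i}. a j i' * (z i * mixed_perm a (R - {i} - {i'}) J z +
          (\<Sum>j'\<in>J. a j' i * mixed_perm a (R - {i} - {i'}) (J - {j'}) z)))"
    using insert by (intro sum.cong refl) (subst insert.IH, auto simp: sw)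
  also have "\<dots> = z i * mixed_perm a (R - {i}) (insert j J) z +
      (\<Sum>j'\<in>J. a j' i * mixed_perm a (R - {i}) (insert j (J - {j'})) z)"
  proof -
    have "(\<Sum>j'\<in>J. a j' i * mixed_perm a (R - {i}) (insert j (J - {j'})) z) =
        (\<Sum>j'\<in>J. \<Sum>i'\<in>R - {i}. a j i' * (a j' i * mixed_perm a (R - {i} - {i'}) (J - {j'}) z))"
      using insert by (simp add: mixed_perm_insert sum_distrib_left mult.left_commute)
    also have "\<dots> = (\<Sum>i'\<in>R - {i}. a j i' *
        (\<Sum>j'\<in>J. a j' i * mixed_perm a (R - {i} - {i'}) (J - {j'}) z))"
      by (subst sum.swap) (simp add: sum_distrib_left)
    finally show ?thesis
      using insert by (simp add: mixed_perm_insert algebra_simps sum.distrib sum_distrib_left)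
  qed
  also have "(\<Sum>j'\<in>J. a j' i * mixed_perm a (R - {i}) (insert j (J - {j'})) z) =
      (\<Sum>j'\<in>J. a j' i * mixed_perm a (R - {i}) (insert j J - {j'}) z)"
    using insert by (intro sum.cong refl) (auto simp: insert_Diff_if)
  finally show ?case using insert by simp
qed

text \<open>Positivity justifies the divisions below; this is why entries are taken strictly
  positive until a final limit.\<close>

lemma mixed_perm_pos:
  assumes "finite R" "finite J" "card J \<le> card R"
    and "\<And>i j. a j i > 0" and "\<And>i. i \<in> R \<Longrightarrow> z i > 0"
  shows "mixed_perm a R J z > 0"
  using assms(2,1,3,5)
proof (induction J arbitrary: R rule: finite_induct)
  case empty
  then show ?case by (simp add: prod_pos)
next
  case (insert j J)
  have "R \<noteq> {}" using insert by auto
  moreover have "mixed_perm a (R - {i}) J z > 0" if "i \<in> R" for i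
    using insert that by (intro insert.IH) auto
  ultimately show ?case
    using insert assms(4) by (auto simp: mixed_perm_insert intro!: sum_pos mult_pos_pos)
qed

section \<open>Log-concavity of mixed permanents\<close>

text \<open>Column expansion writes the ratio as a combination of the quotients
  \<open>mixed_perm a (R - {i}) J z / mixed_perm a R J z\<close>. Row expansion writes the
  reciprocal of such a quotient as \<open>z i\<close> plus a combination of reciprocals of the same
  kind of ratio for \<open>R - {i}\<close> and \<open>J - {j'}\<close>. Each inversion reverses
  monotonicity, so induction on \<open>card J\<close> closes.\<close>

lemma mixed_perm_ratio_antimono:
  assumes "finite R" "finite J" "j \<notin> J" "card J < card R"
    and pos: "\<And>i j. a j i > 0" and "\<And>i. i \<in> R \<Longrightarrow> 0 < z i \<and> z i \<le> z' i"
  shows "mixed_perm a R (insert j J) z' / mixed_perm a R J z' \<le>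
         mixed_perm a R (insert j J) z / mixed_perm a R J z"
  using assms(1-4,6)
proof (induction "card J" arbitrary: R J j rule: less_induct)
  case less
  note finR = less.prems(1) and finJ = less.prems(2)
  have z: "z i > 0" "z' i > 0" "z i \<le> z' i" if "i \<in> R" for i
    using less.prems(5)[OF that] by auto
  have posJ: "mixed_perm a R J z > 0" "mixed_perm a R J z' > 0"
    using less.prems z pos by (auto intro!: mixed_perm_pos)
  have term_le: "mixed_perm a (R - {i}) J z' / mixed_perm a R J z' \<le>
      mixed_perm a (R - {i}) J z / mixed_perm a R J z" if i: "i \<in> R" for i
  proof -
    have card: "card J \<le> card (R - {i})" using less.prems i by simp
    have p: "mixed_perm a (R - {i}) J z > 0" "mixed_perm a (R - {i}) J z' > 0"
      using less.prems card z pos by (auto intro!: mixed_perm_pos)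
    have ratio: "mixed_perm a (R - {i}) (J - {j'}) z / mixed_perm a (R - {i}) J z \<le>
        mixed_perm a (R - {i}) (J - {j'}) z' / mixed_perm a (R - {i}) J z'" if j': "j' \<in> J" for j'
    proof -
      have c: "card (J - {j'}) < card J" using finJ j' by (intro psubset_card_mono) auto
      have q: "mixed_perm a (R - {i}) (J - {j'}) z > 0" "mixed_perm a (R - {i}) (J - {j'}) z' > 0"
        using less.prems card c z pos by (auto intro!: mixed_perm_pos)
      have "mixed_perm a (R - {i}) (insert j' (J - {j'})) z' / mixed_perm a (R - {i}) (J - {j'}) z' \<le>
          mixed_perm a (R - {i}) (insert j' (J - {j'})) z / mixed_perm a (R - {i}) (J - {j'}) z"
        using less.prems card c by (intro less.hyps) auto
      then show ?thesis
        using j' p q by (simp add: insert_absorb field_simps)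
    qed
    have expand: "mixed_perm a R J y / mixed_perm a (R - {i}) J y =
        y i + (\<Sum>j'\<in>J. a j' i * (mixed_perm a (R - {i}) (J - {j'}) y / mixed_perm a (R - {i}) J y))"
      if "mixed_perm a (R - {i}) J y > 0" for y
      using that by (simp add: mixed_perm_row[OF finR finJ i] add_divide_distrib sum_divide_distrib)
    have "mixed_perm a R J z / mixed_perm a (R - {i}) J z \<le>
        mixed_perm a R J z' / mixed_perm a (R - {i}) J z'"
      unfolding expand[OF p(1)] expand[OF p(2)]
      using z[OF i] ratio pos by (intro add_mono sum_mono mult_left_mono) (auto intro: less_imp_le)
    then show ?thesis
      using p posJ by (simp add: field_simps)
  qed
  have "mixed_perm a R (insert j J) y / mixed_perm a R J y =
      (\<Sum>i\<in>R. a j i * (mixed_perm a (R - {i}) J y / mixed_perm a R J y))" for y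
    using less.prems by (simp add: mixed_perm_insert sum_divide_distrib)
  then show ?case
    using term_le pos by (simp only:) (intro sum_mono mult_left_mono, auto intro: less_imp_le)
qed

text \<open>By the product rule, differentiating the product over uncovered rows in the direction
  \<open>a j\<close> assigns one of these rows to \<open>j\<close>.\<close>

lemma mixed_perm_has_derivative:
  assumes "finite R" "finite J" "j \<notin> J"
  shows "((\<lambda>t. mixed_perm a R J (\<lambda>i. z i + t * a j i)) has_real_derivative
           mixed_perm a R (insert j J) (\<lambda>i. z i + t * a j i)) (at t)"
  using assms(2,1,3)
proof (induction J arbitrary: R rule: finite_induct)
  case empty
  have "((\<lambda>t. \<Prod>i\<in>R. z i + t * a j i) has_real_derivative
      (\<Sum>i\<in>R. a j i * (\<Prod>i\<in>R - {i}. z i + t * a j i))) (at t)"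
    by (rule has_field_derivative_prod) (auto intro!: derivative_eq_intros)
  then show ?case using empty by (simp add: mixed_perm_insert)
next
  case (insert l J)
  have "((\<lambda>t. \<Sum>i\<in>R. a l i * mixed_perm a (R - {i}) J (\<lambda>i. z i + t * a j i)) has_real_derivative
      (\<Sum>i\<in>R. a l i * mixed_perm a (R - {i}) (insert j J) (\<lambda>i. z i + t * a j i))) (at t)"
    using insert by (intro DERIV_sum DERIV_cmult insert.IH) auto
  moreover have "mixed_perm a R (insert l J) y = (\<Sum>i\<in>R. a l i * mixed_perm a (R - {i}) J y)" for y
    using insert by (intro mixed_perm_insert) auto
  moreover have "mixed_perm a R (insert j (insert l J)) y =
      (\<Sum>i\<in>R. a l i * mixed_perm a (R - {i}) (insert j J) y)" for y
    unfolding insert_commute[of j] using insert by (intro mixed_perm_insert) auto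
  ultimately show ?case by simp
qed

text \<open>
  The ratio in \<open>mixed_perm_ratio_antimono\<close> is the logarithmic derivative of the mixed permanent
  in the direction \<open>a j\<close>, so the mixed permanent is log-concave in that direction.
\<close>

lemma mixed_perm_le_exp:
  assumes "finite R" "finite J" "j \<notin> J" "card J < card R"
    and pos: "\<And>i j. a j i > 0" and zpos: "\<And>i. i \<in> R \<Longrightarrow> z i > 0" and "t \<ge> 0"
  shows "mixed_perm a R J (\<lambda>i. z i + t * a j i) \<le>
    mixed_perm a R J z * exp (t * (mixed_perm a R (insert j J) z / mixed_perm a R J z))"
proof -
  define \<rho> where "\<rho> = mixed_perm a R (insert j J) z / mixed_perm a R J z"
  define g where "g s = mixed_perm a R J (\<lambda>i. z i + s * a j i)" for s
  have gpos: "g s > 0" if "s \<ge> 0" for s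
    unfolding g_def using assms that by (intro mixed_perm_pos) (auto intro!: add_pos_nonneg mult_nonneg_nonneg intro: less_imp_le)
  \<comment> \<open>The logarithmic derivative of \<open>g\<close> stays below its value
    \<open>\<rho>\<close> at 0, so \<open>g s * exp (- (s * \<rho>))\<close> is
    nonincreasing.\<close>
  have "g t * exp (- (t * \<rho>)) \<le> g 0 * exp (- (0 * \<rho>))"
  proof (rule DERIV_nonpos_imp_nonincreasing[OF \<open>t \<ge> 0\<close>])
    fix s :: real assume s: "0 \<le> s" "s \<le> t"
    let ?g' = "mixed_perm a R (insert j J) (\<lambda>i. z i + s * a j i)"
    have "(g has_real_derivative ?g') (at s)"
      unfolding g_def using assms by (intro mixed_perm_has_derivative)
    then have "((\<lambda>s. g s * exp (- (s * \<rho>))) has_real_derivative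
        (?g' - g s * \<rho>) * exp (- (s * \<rho>))) (at s)"
      by (auto intro!: derivative_eq_intros simp: algebra_simps)
    moreover have "?g' / g s \<le> \<rho>"
      unfolding g_def \<rho>_def using assms s
      by (intro mixed_perm_ratio_antimono) (auto simp: less_imp_le)
    then have "?g' - g s * \<rho> \<le> 0"
      using gpos[OF s(1)] by (simp add: field_simps)
    ultimately show "\<exists>y. ((\<lambda>s. g s * exp (- (s * \<rho>))) has_real_derivative y) (at s) \<and> y \<le> 0"
      by (meson exp_ge_zero mult_nonpos_nonneg)
  qed
  then have "g t \<le> g 0 * exp (t * \<rho>)"
    by (simp add: exp_minus field_simps)
  then show ?thesis by (simp add: g_def \<rho>_def)
qed

section \<open>Capacity and the permanent of a regular matrix\<close>

text \<open>Gurvits' inequality: \<open>C\<close> is a lower bound for the capacity of the product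
  of linear forms, and each variable traded for a differentiation costs a factor
  \<open>exp 1\<close>. The shift \<open>\<eta>\<close> keeps the arguments positive when no
  variable is left.\<close>

lemma mixed_perm_capacity:
  fixes a :: "'a \<Rightarrow> 'b \<Rightarrow> real"
  assumes fin: "finite R" "finite V" "card V \<le> card R" and "J \<subseteq> V"
    and pos: "\<And>i j. a j i > 0" and \<eta>: "\<eta> > 0" and "C \<ge> 0"
    and cap: "\<And>x. (\<And>l. l \<in> V \<Longrightarrow> x l > 0) \<Longrightarrow> C * (\<Prod>l\<in>V. x l) \<le> (\<Prod>i\<in>R. \<Sum>l\<in>V. x l * a l i)"
    and x: "\<And>l. l \<in> V - J \<Longrightarrow> x l > 0"
  shows "exp (- real (card J)) * C * (\<Prod>l\<in>V - J. x l) \<le>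
    mixed_perm a R J (\<lambda>i. \<eta> + (\<Sum>l\<in>V - J. x l * a l i))"
proof -
  have "finite J" using fin \<open>J \<subseteq> V\<close> finite_subset by auto
  then show ?thesis using \<open>J \<subseteq> V\<close> x
  proof (induction J arbitrary: x rule: finite_induct)
    case empty
    have "C * (\<Prod>l\<in>V. x l) \<le> (\<Prod>i\<in>R. \<Sum>l\<in>V. x l * a l i)"
      using empty by (intro cap) auto
    also have "\<dots> \<le> (\<Prod>i\<in>R. \<eta> + (\<Sum>l\<in>V. x l * a l i))"
      using empty \<eta> pos by (intro prod_mono) (auto intro!: sum_nonneg mult_nonneg_nonneg simp: less_imp_le)
    finally show ?case by simp
  next
    case (insert j J)
    let ?z = "\<lambda>i. \<eta> + (\<Sum>l\<in>V - insert j J. x l * a l i)"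
    have finJ: "finite J" "j \<notin> J" and j: "j \<in> V" and JV: "J \<subseteq> V" using insert by auto
    have card: "card J < card R"
    proof -
      have "card J < card V" using fin insert by (intro psubset_card_mono) auto
      then show ?thesis using fin by simp
    qed
    have zpos: "?z i > 0" for i
      using insert.prems \<eta> pos by (intro add_pos_nonneg sum_nonneg) (auto intro!: mult_nonneg_nonneg simp: less_imp_le)
    let ?Q = "mixed_perm a R J ?z" and ?Q' = "mixed_perm a R (insert j J) ?z"
    have Q: "?Q > 0"
      using fin finJ card zpos pos by (intro mixed_perm_pos) auto
    have cardI: "card (insert j J) \<le> card R" using card finJ by simp
    have Q': "?Q' > 0"
      using fin finJ zpos pos cardI by (intro mixed_perm_pos) auto
    \<comment> \<open>the \<open>t\<close> minimising \<open>exp (t * (?Q' / ?Q)) / t\<close>\<close>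
    define t where "t = ?Q / ?Q'"
    have t: "t > 0" using Q Q' by (simp add: t_def)
    have VJ: "V - J = insert j (V - insert j J)" using j insert by auto
    \<comment> \<open>The induction hypothesis with \<open>t\<close> as value of the variable
      \<open>j\<close> turns the argument into \<open>?z\<close> shifted in the direction
      \<open>a j\<close>.\<close>
    have "exp (- real (card J)) * C * (\<Prod>l\<in>V - J. (x(j := t)) l) \<le>
        mixed_perm a R J (\<lambda>i. \<eta> + (\<Sum>l\<in>V - J. (x(j := t)) l * a l i))"
      using insert.prems t by (intro insert.IH JV) auto
    also have "(\<Prod>l\<in>V - J. (x(j := t)) l) = t * (\<Prod>l\<in>V - insert j J. x l)"
      unfolding VJ using fin by (subst prod.insert) (auto intro!: prod.cong)
    also have "(\<lambda>i. \<eta> + (\<Sum>l\<in>V - J. (x(j := t)) l * a l i)) = (\<lambda>i. ?z i + t * a j i)"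
    proof
      fix i
      have "(\<Sum>l\<in>V - J. (x(j := t)) l * a l i) = t * a j i + (\<Sum>l\<in>V - insert j J. x l * a l i)"
        unfolding VJ using fin by (subst sum.insert) (auto intro!: sum.cong)
      then show "\<eta> + (\<Sum>l\<in>V - J. (x(j := t)) l * a l i) = ?z i + t * a j i" by simp
    qed
    also have "mixed_perm a R J (\<lambda>i. ?z i + t * a j i) \<le> ?Q * exp (t * (?Q' / ?Q))"
      using fin finJ card pos zpos t by (intro mixed_perm_le_exp) auto
    also have "\<dots> = exp 1 * t * ?Q'"
      using Q Q' by (simp add: t_def)
    finally have "exp (- real (card J)) * C * (\<Prod>l\<in>V - insert j J. x l) \<le> exp 1 * ?Q'"
      using t by (simp add: mult.assoc mult.left_commute[of _ t])
    moreover have "exp (- real (card J)) = exp 1 * exp (- real (card (insert j J)))"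
      using finJ by (simp flip: exp_add)
    ultimately have "exp 1 * (exp (- real (card (insert j J))) * C * (\<Prod>l\<in>V - insert j J. x l)) \<le> exp 1 * ?Q'"
      by (simp only: mult.assoc)
    then show ?case by (subst (asm) mult_le_cancel_left_pos) simp_all
  qed
qed

lemma mixed_perm_permutes:
  "mixed_perm a V V z = (\<Sum>p | p permutes V. \<Prod>v\<in>V. a v (p v))" if "finite V"
  unfolding mixed_perm_def
proof (rule sum.reindex_bij_witness[where i = "\<lambda>p. restrict p V"
      and j = "\<lambda>f v. if v \<in> V then f v else v"])
  fix f assume f: "f \<in> {f \<in> V \<rightarrow>\<^sub>E V. inj_on f V}"
  then have "f ` V = V" using that by (intro card_subset_eq) (auto simp: card_image)
  then have "bij_betw f V V" using f by (auto simp: bij_betw_def)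
  then have "bij_betw (\<lambda>v. if v \<in> V then f v else v) V V"
    by (subst bij_betw_cong[where g = f]) auto
  then show "(\<lambda>v. if v \<in> V then f v else v) \<in> {p. p permutes V}"
    by (auto intro: bij_imp_permutes)
  show "(\<Prod>v\<in>V. a v (if v \<in> V then f v else v)) = (\<Prod>j\<in>V. a j (f j)) * prod z (V - f ` V)"
    using \<open>f ` V = V\<close> by simp
  show "restrict (\<lambda>v. if v \<in> V then f v else v) V = f"
    using f by (auto simp: fun_eq_iff PiE_def extensional_def)
next
  fix p assume p: "p \<in> {p. p permutes V}"
  then show "(\<lambda>v. if v \<in> V then restrict p V v else v) = p"
    by (auto simp: fun_eq_iff permutes_not_in)
  show "restrict p V \<in> {f \<in> V \<rightarrow>\<^sub>E V. inj_on f V}"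
    using p by (auto simp: permutes_in_image inj_on_def dest: permutes_inj injD)
qed

text \<open>Weighted arithmetic-geometric mean in each column: \<open>m i\<close> is the logarithm
  of the geometric mean of \<open>x\<close> with weights \<open>a l i / d\<close>. Since rows also
  sum to \<open>d\<close>, each \<open>ln (x l)\<close> receives total weight 1 when the columns are
  multiplied.\<close>

lemma regular_capacity:
  fixes a :: "'a \<Rightarrow> 'a \<Rightarrow> real"
  assumes "finite V" and "d > 0" and nonneg: "\<And>u v. a u v \<ge> 0"
    and row: "\<And>u. u \<in> V \<Longrightarrow> (\<Sum>v\<in>V. a u v) = d"
    and col: "\<And>v. v \<in> V \<Longrightarrow> (\<Sum>u\<in>V. a u v) = d"
    and x: "\<And>v. v \<in> V \<Longrightarrow> x v > 0"
  shows "d ^ card V * (\<Prod>v\<in>V. x v) \<le> (\<Prod>i\<in>V. \<Sum>l\<in>V. x l * a l i)"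
proof -
  define m where "m i = (\<Sum>l\<in>V. a l i * ln (x l)) / d" for i
  have le: "d * exp (m i) \<le> (\<Sum>l\<in>V. x l * a l i)" if i: "i \<in> V" for i
  proof -
    \<comment> \<open>The deviations \<open>ln (x l) - m i\<close> have weighted sum 0, which
      prepares the termwise use of \<open>1 + s \<le> exp s\<close>.\<close>
    have "d * exp (m i) = exp (m i) * (\<Sum>l\<in>V. a l i * (1 + (ln (x l) - m i)))"
    proof -
      have "(\<Sum>l\<in>V. a l i * (1 + (ln (x l) - m i))) =
          (\<Sum>l\<in>V. a l i) + (\<Sum>l\<in>V. a l i * ln (x l)) - (\<Sum>l\<in>V. a l i) * m i"
        by (simp add: algebra_simps sum.distrib sum_subtractf sum_distrib_left)
      also have "\<dots> = d" using \<open>d > 0\<close> by (simp add: col[OF i]) (simp add: m_def)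
      finally show ?thesis by simp
    qed
    also have "\<dots> \<le> exp (m i) * (\<Sum>l\<in>V. a l i * exp (ln (x l) - m i))"
      using nonneg by (intro mult_left_mono sum_mono exp_ge_add_one_self) auto
    also have "\<dots> = (\<Sum>l\<in>V. x l * a l i)"
      using x by (auto simp: sum_distrib_left exp_diff intro!: sum.cong)
    finally show ?thesis .
  qed
  have "(\<Sum>i\<in>V. m i) = (\<Sum>l\<in>V. (\<Sum>i\<in>V. a l i) * ln (x l)) / d"
    unfolding m_def sum_divide_distrib[symmetric] sum_distrib_right by (subst sum.swap) simp
  also have "\<dots> = (\<Sum>l\<in>V. ln (x l))"
    using \<open>d > 0\<close> by (simp add: row flip: sum_distrib_left)
  finally have "(\<Prod>v\<in>V. x v) = exp (\<Sum>i\<in>V. m i)"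
    using x \<open>finite V\<close> by (simp add: exp_sum)
  then have "d ^ card V * (\<Prod>v\<in>V. x v) = (\<Prod>i\<in>V. d * exp (m i))"
    using \<open>finite V\<close> by (simp add: exp_sum prod.distrib)
  also have "\<dots> \<le> (\<Prod>i\<in>V. \<Sum>l\<in>V. x l * a l i)"
    using le \<open>d > 0\<close> by (intro prod_mono) auto
  finally show ?thesis .
qed

text \<open>The capacity inequality at \<open>J = V\<close>, where the mixed permanent is a
  permanent. Zero entries are handled by passing to \<open>a u v + \<epsilon>\<close>, which keeps
  the capacity bound, and letting \<open>\<epsilon>\<close> tend to 0.\<close>

lemma permanent_regular_ge:
  fixes a :: "'a \<Rightarrow> 'a \<Rightarrow> real"
  assumes "finite V" and "d > 0" and nonneg: "\<And>u v. a u v \<ge> 0"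
    and row: "\<And>u. u \<in> V \<Longrightarrow> (\<Sum>v\<in>V. a u v) = d"
    and col: "\<And>v. v \<in> V \<Longrightarrow> (\<Sum>u\<in>V. a u v) = d"
  shows "(d / exp 1) ^ card V \<le> (\<Sum>p | p permutes V. \<Prod>v\<in>V. a v (p v))"
proof -
  have bound: "(d / exp 1) ^ card V \<le> (\<Sum>p | p permutes V. \<Prod>v\<in>V. a v (p v) + \<epsilon>)" if \<epsilon>: "\<epsilon> > 0" for \<epsilon>
  proof -
    let ?a = "\<lambda>u v. a u v + \<epsilon>"
    have "exp (- real (card V)) * d ^ card V * (\<Prod>l\<in>V - V. 1) \<le>
        mixed_perm ?a V V (\<lambda>i. 1 + (\<Sum>l\<in>V - V. 1 * ?a l i))"
    proof (rule mixed_perm_capacity)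
      fix x :: "'a \<Rightarrow> real" assume x: "\<And>l. l \<in> V \<Longrightarrow> x l > 0"
      have "d ^ card V * (\<Prod>v\<in>V. x v) \<le> (\<Prod>i\<in>V. \<Sum>l\<in>V. x l * a l i)"
        using assms x by (intro regular_capacity) auto
      also have "\<dots> \<le> (\<Prod>i\<in>V. \<Sum>l\<in>V. x l * (a l i + \<epsilon>))"
        using x nonneg \<epsilon> by (intro prod_mono conjI sum_mono sum_nonneg mult_left_mono) (auto simp: less_imp_le)
      finally show "d ^ card V * (\<Prod>v\<in>V. x v) \<le> (\<Prod>i\<in>V. \<Sum>l\<in>V. x l * (a l i + \<epsilon>))" .
    qed (use assms \<epsilon> in \<open>auto intro!: add_nonneg_pos\<close>)
    moreover have "exp (- real (card V)) * d ^ card V = (d / exp 1) ^ card V"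
      using exp_of_nat_mult[of "card V" "1 :: real"] by (simp add: exp_minus power_divide field_simps)
    ultimately show ?thesis
      using \<open>finite V\<close> by (simp add: mixed_perm_permutes)
  qed
  have "((\<lambda>\<epsilon>. \<Sum>p | p permutes V. \<Prod>v\<in>V. a v (p v) + \<epsilon>) \<longlongrightarrow>
      (\<Sum>p | p permutes V. \<Prod>v\<in>V. a v (p v) + 0)) (at_right 0)"
    by (intro tendsto_intros)
  then have "(d / exp 1) ^ card V \<le> (\<Sum>p | p permutes V. \<Prod>v\<in>V. a v (p v) + 0)"
    by (rule tendsto_lowerbound) (auto simp: eventually_at_right_field intro!: exI[of _ 1] bound)
  then show ?thesis by simp
qed

section \<open>Determinants and transversal principal minors\<close>

lemma prod_le_mean_power:
  fixes r :: "'a \<Rightarrow> real"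
  assumes "finite S" and "\<And>i. i \<in> S \<Longrightarrow> r i \<ge> 0" and "(\<Sum>i\<in>S. r i) \<le> real (card S) * c"
  shows "(\<Prod>i\<in>S. r i) \<le> c ^ card S"
proof (cases "S = {}")
  case False
  then have n: "card S > 0" using assms by (simp add: card_gt_0_iff)
  define P where "P = (\<Prod>i\<in>S. r i)"
  have P: "P \<ge> 0" unfolding P_def using assms by (intro prod_nonneg) auto
  have "P powr (1 / real (card S)) \<le> (\<Sum>i\<in>S. r i / real (card S))"
    unfolding P_def using assms False by (intro arith_geom_mean) auto
  also have "\<dots> \<le> c"
    using n assms(3) by (simp add: divide_le_eq mult.commute flip: sum_divide_distrib)
  finally have "(P powr (1 / real (card S))) ^ card S \<le> c ^ card S"
    by (intro power_mono) auto
  also have "(P powr (1 / real (card S))) ^ card S = P"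
    using n P by (cases "P = 0") (simp_all add: powr_powr flip: powr_realpow)
  finally show ?thesis by (simp add: P_def)
qed simp

lemma sum_diag_mult_commute:
  fixes A B :: "'a :: comm_semiring_0 mat"
  assumes "A \<in> carrier_mat n n" "B \<in> carrier_mat n n"
  shows "(\<Sum>i<n. (A * B) $$ (i, i)) = (\<Sum>i<n. (B * A) $$ (i, i))"
proof -
  have "(\<Sum>i<n. (A * B) $$ (i, i)) = (\<Sum>i<n. \<Sum>j<n. A $$ (i, j) * B $$ (j, i))"
    using assms by (intro sum.cong) (auto simp: scalar_prod_def lessThan_atLeast0 intro!: sum.cong)
  also have "\<dots> = (\<Sum>j<n. \<Sum>i<n. B $$ (j, i) * A $$ (i, j))"
    by (subst sum.swap) (simp add: mult.commute)
  also have "\<dots> = (\<Sum>i<n. (B * A) $$ (i, i))"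
    using assms by (intro sum.cong) (auto simp: scalar_prod_def lessThan_atLeast0 intro!: sum.cong)
  finally show ?thesis .
qed

lemma scalar_prod_conjugate_complex:
  "v \<bullet>c v = complex_of_real (\<Sum>i<n. (cmod (v $ i))\<^sup>2)" if "v \<in> carrier_vec n"
  using that by (auto simp: scalar_prod_def lessThan_atLeast0 complex_norm_square simp flip: of_real_power intro!: sum.cong)

text \<open>
  Arithmetic-geometric mean inequality for the eigenvalues of \<open>B B\<^sup>*\<close>, which are nonnegative and
  sum to the squared Frobenius norm of \<open>B\<close>.
\<close>

lemma det_norm_le_Frobenius:
  fixes B :: "complex mat"
  assumes B: "B \<in> carrier_mat n n"
    and le: "(\<Sum>i<n. \<Sum>j<n. (cmod (B $$ (i, j)))\<^sup>2) \<le> real n * c"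
  shows "(cmod (Determinant.det B))\<^sup>2 \<le> c ^ n"
proof -
  define B' where "B' = transpose_mat (map_mat cnj B)"
  define H where "H = B * B'"
  have B': "B' \<in> carrier_mat n n" and H: "H \<in> carrier_mat n n"
    using B by (auto simp: B'_def H_def)
  interpret cnj: comm_ring_hom cnj by standard auto
  have "Determinant.det B' = cnj (Determinant.det B)"
    using B by (simp add: B'_def Determinant.det_transpose[of _ n])
  then have "Determinant.det H = Determinant.det B * cnj (Determinant.det B)"
    using B B' by (simp add: H_def Determinant.det_mult[of _ n])
  then have detH: "Determinant.det H = complex_of_real ((cmod (Determinant.det B))\<^sup>2)"
    by (simp only: complex_norm_square)
  obtain es where es: "char_poly H = (\<Prod>e\<leftarrow>es. [:- e, 1:])" "length es = n"
    using char_poly_factorized[OF H] by blast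
  obtain T P Q where TPQ: "schur_decomposition H es = (T, P, Q)" by (metis prod_cases3)
  have wit: "similar_mat_wit H T P Q" and T: "upper_triangular T" "diag_mat T = es"
    using schur_decomposition[OF H es(1) TPQ] by auto
  note wit' = similar_mat_witD2[OF H wit]
  have "Determinant.det H = Determinant.det T" using wit by (intro det_similar) (auto simp: similar_mat_def)
  then have det_es: "Determinant.det H = prod_list es"
    using Determinant.det_upper_triangular[OF T(1) wit'(5)] T(2) by simp
  \<comment> \<open>Similarity to the triangular \<open>T\<close> preserves the trace, so the
    diagonal sum of \<open>H\<close> is the sum of its eigenvalues \<open>es\<close>.\<close>
  have "(\<Sum>i<n. H $$ (i, i)) = (\<Sum>i<n. (P * (T * Q)) $$ (i, i))"
    using wit' by (simp add: assoc_mult_mat)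
  also have "\<dots> = (\<Sum>i<n. (T * Q * P) $$ (i, i))"
    using wit' by (intro sum_diag_mult_commute) auto
  also have "T * Q * P = T" using wit' by (simp add: assoc_mult_mat)
  also have "(\<Sum>i<n. T $$ (i, i)) = (\<Sum>i<n. es ! i)"
    using T(2) wit' by (intro sum.cong) (auto simp: diag_mat_def)
  finally have tr: "(\<Sum>i<n. H $$ (i, i)) = (\<Sum>i<n. es ! i)" .
  have Hii: "H $$ (i, i) = complex_of_real (\<Sum>j<n. (cmod (B $$ (i, j)))\<^sup>2)" if "i < n" for i
    using B that by (auto simp: H_def B'_def scalar_prod_def lessThan_atLeast0 complex_norm_square
        simp flip: of_real_power intro!: sum.cong)
  \<comment> \<open>For an eigenvector \<open>v\<close>, pairing \<open>H *\<^sub>v v\<close> with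
    \<open>v\<close> gives the squared norm of \<open>B' *\<^sub>v v\<close>, so the eigenvalue is a
    quotient of squared norms.\<close>
  have ev: "\<exists>r\<ge>0. es ! i = complex_of_real r" if "i < n" for i
  proof -
    have "poly (char_poly H) (es ! i) = 0"
      unfolding es(1) poly_prod_list using that es(2) by (auto simp: prod_list_zero_iff)
    then obtain v where v: "v \<in> carrier_vec n" "v \<noteq> 0\<^sub>v n" "H *\<^sub>v v = (es ! i) \<cdot>\<^sub>v v"
      using eigenvalue_root_char_poly[OF H] H unfolding eigenvalue_def eigenvector_def by auto
    define u where "u = B' *\<^sub>v v"
    have u: "u \<in> carrier_vec n" using B' v by (simp add: u_def)
    have "(es ! i) * (v \<bullet>c v) = (H *\<^sub>v v) \<bullet>c v" using v by simp
    also have "\<dots> = conjugate v \<bullet> (B *\<^sub>v u)"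
      using B B' v by (subst comm_scalar_prod[of _ n]) (auto simp: H_def u_def)
    also have "\<dots> = (transpose_mat B *\<^sub>v conjugate v) \<bullet> u"
      using B u v by (subst transpose_vec_mult_scalar[OF B]) auto
    also have "transpose_mat B *\<^sub>v conjugate v = conjugate u"
      using B v by (intro eq_vecI) (auto simp: u_def B'_def scalar_prod_def)
    also have "conjugate u \<bullet> u = u \<bullet>c u" using u by (subst comm_scalar_prod[of _ n]) auto
    finally have eq: "(es ! i) * complex_of_real (\<Sum>i<n. (cmod (v $ i))\<^sup>2) =
        complex_of_real (\<Sum>i<n. (cmod (u $ i))\<^sup>2)"
      using u v by (simp only: scalar_prod_conjugate_complex)
    have "v \<bullet>c v \<noteq> 0" using v by (subst conjugate_square_eq_0_vec) auto
    then have "(\<Sum>i<n. (cmod (v $ i))\<^sup>2) \<noteq> 0"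
      using v(1) by (simp only: scalar_prod_conjugate_complex of_real_eq_0_iff) simp
    then have "es ! i = complex_of_real ((\<Sum>i<n. (cmod (u $ i))\<^sup>2) / (\<Sum>i<n. (cmod (v $ i))\<^sup>2))"
      using eq by (simp add: field_simps del: of_real_sum)
    moreover have "(\<Sum>i<n. (cmod (u $ i))\<^sup>2) / (\<Sum>i<n. (cmod (v $ i))\<^sup>2) \<ge> 0"
      by (intro divide_nonneg_nonneg sum_nonneg zero_le_power2)
    ultimately show ?thesis by blast
  qed
  then obtain r where r: "\<And>i. i < n \<Longrightarrow> r i \<ge> 0" "\<And>i. i < n \<Longrightarrow> es ! i = complex_of_real (r i)"
    by metis
  have "complex_of_real ((cmod (Determinant.det B))\<^sup>2) = complex_of_real (\<Prod>i<n. r i)"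
    using det_es es(2) r by (simp add: detH prod.list_conv_set_nth lessThan_atLeast0)
  then have "(cmod (Determinant.det B))\<^sup>2 = (\<Prod>i<n. r i)" by (simp only: of_real_eq_iff)
  also have "\<dots> \<le> c ^ card {..<n}"
  proof (rule prod_le_mean_power)
    have "complex_of_real (\<Sum>i<n. r i) = complex_of_real (\<Sum>i<n. \<Sum>j<n. (cmod (B $$ (i, j)))\<^sup>2)"
      using tr r Hii by simp
    then show "(\<Sum>i<n. r i) \<le> real (card {..<n}) * c"
      using le by (simp only: of_real_eq_iff card_lessThan)
  qed (use r in auto)
  finally show ?thesis by simp
qed

section \<open>Indexed determinants, principal minors and coefficient extraction\<close>

text \<open>Conjugation by \<open>h\<close> preserves signs. This moves determinants to the index
  set of a matrix, and principal minors from graphs of functions back to \<open>V\<close>.\<close>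

lemma sum_permutes_reindex:
  fixes M :: "'b \<Rightarrow> 'b \<Rightarrow> 'c :: comm_ring_1"
  assumes h: "bij_betw h A B" and "finite A"
  shows "(\<Sum>q | q permutes B. of_int (sign q) * (\<Prod>y\<in>B. M y (q y))) =
    (\<Sum>p | p permutes A. of_int (sign p) * (\<Prod>x\<in>A. M (h x) (h (p x))))"
proof (rule sum.reindex_bij_witness[where j = "map_permutation B (inv_into A h)"
      and i = "map_permutation A h"])
  have inj: "inj_on h A" and im: "h ` A = B" using h by (auto simp: bij_betw_def)
  have h': "bij_betw (inv_into A h) B A" using h by (rule bij_betw_inv_into)
  fix q assume "q \<in> {q. q permutes B}"
  then have q: "q permutes B" by simp
  show "map_permutation A h (map_permutation B (inv_into A h) q) = q"
    by (rule map_permutation_compose_inv[OF h' q]) (use im f_inv_into_f[of _ h A] in auto)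
  show "map_permutation B (inv_into A h) q \<in> {p. p permutes A}"
    using map_permutation_permutes[OF h' q] by simp
  have "finite B" using im \<open>finite A\<close> by auto
  then have "sign (map_permutation B (inv_into A h) q) = sign q"
    using h' q by (intro sign_map_permutation) (auto simp: bij_betw_def)
  moreover have "(\<Prod>y\<in>B. M y (q y)) = (\<Prod>x\<in>A. M (h x) (q (h x)))"
    using prod.reindex_bij_betw[OF h, of "\<lambda>y. M y (q y)"] by simp
  moreover have "h (map_permutation B (inv_into A h) q x) = q (h x)" if "x \<in> A" for x
  proof -
    have hx: "h x \<in> B" using that im by auto
    have "map_permutation B (inv_into A h) q (inv_into A h (h x)) = inv_into A h (q (h x))"
      using h' hx by (intro map_permutation_apply) (auto simp: bij_betw_def)
    then show ?thesis
      using that inj im q hx by (simp add: f_inv_into_f permutes_in_image)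
  qed
  ultimately show "of_int (sign (map_permutation B (inv_into A h) q)) *
      (\<Prod>x\<in>A. M (h x) (h (map_permutation B (inv_into A h) q x))) =
      of_int (sign q) * (\<Prod>y\<in>B. M y (q y))"
    by simp
next
  have inj: "inj_on h A" and im: "h ` A = B" using h by (auto simp: bij_betw_def)
  fix p assume "p \<in> {p. p permutes A}"
  then have p: "p permutes A" by simp
  show "map_permutation B (inv_into A h) (map_permutation A h p) = p"
    by (rule map_permutation_compose_inv[OF h p]) (use inj in auto)
  show "map_permutation A h p \<in> {q. q permutes B}"
    using map_permutation_permutes[OF h p] by simp
qed

lemma signed_sum_permutes_norm_le:
  fixes M :: "'a \<Rightarrow> 'a \<Rightarrow> complex"
  assumes "finite X" and le: "(\<Sum>x\<in>X. \<Sum>y\<in>X. (cmod (M x y))\<^sup>2) \<le> real (card X) * c"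
  shows "(cmod (\<Sum>p | p permutes X. of_int (sign p) * (\<Prod>x\<in>X. M x (p x))))\<^sup>2 \<le> c ^ card X"
proof -
  let ?n = "card X"
  obtain h where h: "bij_betw h {0..<?n} X" using ex_bij_betw_nat_finite[OF \<open>finite X\<close>] by blast
  define B where "B = Matrix.mat ?n ?n (\<lambda>(i, j). M (h i) (h j))"
  have B: "B \<in> carrier_mat ?n ?n" by (simp add: B_def)
  have "(\<Sum>p | p permutes X. of_int (sign p) * (\<Prod>x\<in>X. M x (p x))) =
      (\<Sum>p | p permutes {0..<?n}. of_int (sign p) * (\<Prod>i\<in>{0..<?n}. M (h i) (h (p i))))"
    using h by (intro sum_permutes_reindex) auto
  also have "\<dots> = Determinant.det B"
    unfolding Determinant.det_def'[OF B]
    by (intro sum.cong refl arg_cong2[of _ _ _ _ "(*)"] prod.cong)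
      (auto simp: B_def dest: permutes_in_image[where x = i for i])
  finally have det: "(\<Sum>p | p permutes X. of_int (sign p) * (\<Prod>x\<in>X. M x (p x))) = Determinant.det B" .
  have "(\<Sum>i<?n. \<Sum>j<?n. (cmod (B $$ (i, j)))\<^sup>2) =
      (\<Sum>i\<in>{0..<?n}. \<Sum>j\<in>{0..<?n}. (cmod (M (h i) (h j)))\<^sup>2)"
    by (intro sum.cong) (auto simp: B_def)
  also have "\<dots> = (\<Sum>x\<in>X. \<Sum>y\<in>X. (cmod (M x y))\<^sup>2)"
    by (simp add: sum.reindex_bij_betw[OF h, of "\<lambda>y. (cmod (M _ y))\<^sup>2"]
        sum.reindex_bij_betw[OF h, of "\<lambda>x. \<Sum>y\<in>X. (cmod (M x y))\<^sup>2"])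
  finally show ?thesis
    unfolding det using det_norm_le_Frobenius[OF B] le by simp
qed

text \<open>Expanding the product selects the set \<open>S\<close> of rows where \<open>g\<close> is
  used; the identity factors elsewhere force \<open>p\<close> to fix \<open>X - S\<close>. This is
  the expansion of the determinant of \<open>1 + g\<close> into principal minors.\<close>

lemma sum_permutes_diagonal_expand:
  fixes g :: "'a \<Rightarrow> 'a \<Rightarrow> 'c :: comm_ring_1"
  assumes "finite X"
  shows "(\<Sum>p | p permutes X. of_int (sign p) * (\<Prod>x\<in>X. g x (p x) + of_bool (p x = x))) =
    (\<Sum>S\<in>Pow X. \<Sum>p | p permutes S. of_int (sign p) * (\<Prod>x\<in>S. g x (p x)))"
proof -
  have "(\<Sum>p | p permutes X. of_int (sign p) * (\<Prod>x\<in>X. g x (p x) + of_bool (p x = x))) =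
      (\<Sum>S\<in>Pow X. \<Sum>p | p permutes X. of_int (sign p) *
         ((\<Prod>x\<in>S. g x (p x)) * (\<Prod>x\<in>X - S. of_bool (p x = x))))"
    unfolding prod_add[OF assms] sum_distrib_left by (rule sum.swap)
  also have "\<dots> = (\<Sum>S\<in>Pow X. \<Sum>p | p permutes S. of_int (sign p) * (\<Prod>x\<in>S. g x (p x)))"
  proof (rule sum.cong[OF refl], rule sum.mono_neutral_cong_right)
    fix S assume S: "S \<in> Pow X"
    show "finite {p. p permutes X}" using assms by (rule finite_permutations)
    show "{p. p permutes S} \<subseteq> {p. p permutes X}" using S by (auto intro: permutes_subset)
    show "\<forall>p\<in>{p. p permutes X} - {p. p permutes S}. of_int (sign p) *
        ((\<Prod>x\<in>S. g x (p x)) * (\<Prod>x\<in>X - S. of_bool (p x = x))) = 0"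
    proof (rule ballI)
      fix p assume "p \<in> {p. p permutes X} - {p. p permutes S}"
      then have "p permutes X" "\<not> p permutes S" by auto
      then obtain x where "x \<in> X - S" "p x \<noteq> x" using permutes_superset[of p X S] by auto
      then have "(\<Prod>x\<in>X - S. of_bool (p x = x)) = (0 :: 'c)"
        using assms by (intro prod_zero) auto
      then show "of_int (sign p) * ((\<Prod>x\<in>S. g x (p x)) * (\<Prod>x\<in>X - S. of_bool (p x = x))) = 0"
        by simp
    qed
    fix p assume "p \<in> {p. p permutes S}"
    then have "(\<Prod>x\<in>X - S. of_bool (p x = x)) = (1 :: 'c)"
      by (intro prod.neutral) (auto simp: permutes_not_in)
    then show "of_int (sign p) * ((\<Prod>x\<in>S. g x (p x)) * (\<Prod>x\<in>X - S. of_bool (p x = x))) =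
        of_int (sign p) * (\<Prod>x\<in>S. g x (p x))" by simp
  qed
  finally show ?thesis .
qed

text \<open>The exponent \<open>N\<close> acts as -1 modulo \<open>Suc N\<close>. Since
  \<open>N + r\<close> lies strictly between 0 and \<open>2 * Suc N\<close>, it is divisible by
  \<open>Suc N\<close> only for \<open>r = 1\<close>.\<close>

lemma root_of_unity_filter:
  assumes "N \<ge> 1" and "r \<le> N"
  defines "\<omega> \<equiv> exp (2 * complex_of_real pi * \<i> / complex_of_nat (Suc N))"
  shows "(\<Sum>s<Suc N. (\<omega> ^ s) ^ (N + r)) = (if r = 1 then of_nat (Suc N) else 0)"
proof -
  have pow: "\<omega> ^ j = exp (2 * complex_of_real pi * \<i> * complex_of_nat j / complex_of_nat (Suc N))" for j
    unfolding \<omega>_def by (simp flip: exp_of_nat_mult add: algebra_simps)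
  have one: "\<omega> ^ j = 1 \<longleftrightarrow> Suc N dvd j" for j
    unfolding pow by (rule complex_root_unity_eq_1) simp
  have "(\<Sum>s<Suc N. (\<omega> ^ s) ^ (N + r)) = (\<Sum>s<Suc N. (\<omega> ^ (N + r)) ^ s)"
    by (simp add: mult.commute flip: power_mult)
  also have "\<dots> = (if r = 1 then of_nat (Suc N) else 0)"
  proof (cases "r = 1")
    case True
    then have "\<omega> ^ (N + r) = 1" using one[of "Suc N"] by simp
    then show ?thesis using True by simp
  next
    case False
    have "\<not> Suc N dvd N + r"
    proof
      assume "Suc N dvd N + r"
      then obtain m where m: "N + r = Suc N * m" by (auto simp: dvd_def)
      have "m \<noteq> 0" using m assms by (cases m) auto
      moreover have "m \<noteq> 1" using m False by auto
      ultimately have "Suc N * 2 \<le> Suc N * m" by (intro mult_le_mono2) auto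
      then show False using m assms by simp
    qed
    then have ne: "\<omega> ^ (N + r) \<noteq> 1" using one by simp
    have "(\<omega> ^ (N + r)) ^ Suc N = 1"
      using one[of "(N + r) * Suc N"] by (metis dvd_triv_right power_mult)
    then show ?thesis using geometric_sum[OF ne, of "Suc N"] False by simp
  qed
  finally show ?thesis .
qed

text \<open>A discrete Cauchy formula with one variable per vertex: summing over roots of unity
  keeps only monomials of degree 1 in every variable. \<open>Suc N\<close> roots suffice because the
  \<open>N\<close> points over a vertex bound the degree in its variable.\<close>

lemma multilinear_coefficient:
  fixes D :: "('a \<times> 'i) set \<Rightarrow> complex"
  assumes "finite V" "finite I" and N: "card I = N" "N \<ge> 1"
  defines "\<omega> \<equiv> exp (2 * complex_of_real pi * \<i> / complex_of_nat (Suc N))"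
  shows "(\<Sum>\<zeta>\<in>V \<rightarrow>\<^sub>E {..<Suc N}. (\<Prod>v\<in>V. (\<omega> ^ \<zeta> v) ^ N) *
      (\<Sum>S\<in>Pow (V \<times> I). (\<Prod>x\<in>S. \<omega> ^ \<zeta> (fst x)) * D S)) =
    of_nat (Suc N) ^ card V * (\<Sum>f\<in>V \<rightarrow>\<^sub>E I. D ((\<lambda>v. (v, f v)) ` V))"
proof -
  define fib where "fib S v = {x \<in> S. fst x = v}" for S :: "('a \<times> 'i) set" and v
  have fin: "finite S" if "S \<subseteq> V \<times> I" for S using that assms finite_subset by blast
  have fib_card: "card (fib S v) \<le> N" if "S \<subseteq> V \<times> I" for S v
  proof -
    have "fib S v \<subseteq> {v} \<times> I" using that by (auto simp: fib_def)
    then have "card (fib S v) \<le> card ({v} \<times> I)" using assms by (intro card_mono) auto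
    then show ?thesis using N by (simp add: card_cartesian_product)
  qed
  have group: "(\<Prod>x\<in>S. h (fst x)) = (\<Prod>v\<in>V. h v ^ card (fib S v))"
    if "S \<subseteq> V \<times> I" for S and h :: "'a \<Rightarrow> complex"
  proof -
    have "(\<Prod>x\<in>S. h (fst x)) = (\<Prod>v\<in>V. \<Prod>x\<in>fib S v. h (fst x))"
      unfolding fib_def using that assms fin[OF that] by (subst prod.group) auto
    also have "\<dots> = (\<Prod>v\<in>V. h v ^ card (fib S v))"
      by (intro prod.cong refl) (simp add: fib_def)
    finally show ?thesis .
  qed
  \<comment> \<open>Sets with exactly one point over every vertex are the graphs of functions from
    \<open>V\<close> to \<open>I\<close>.\<close>
  have transversal: "{S \<in> Pow (V \<times> I). \<forall>v\<in>V. card (fib S v) = 1} =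
      (\<lambda>f. (\<lambda>v. (v, f v)) ` V) ` (V \<rightarrow>\<^sub>E I)" (is "?L = ?R")
  proof
    show "?R \<subseteq> ?L"
    proof safe
      fix f v assume f: "f \<in> V \<rightarrow>\<^sub>E I" and v: "v \<in> V"
      have "fib ((\<lambda>v. (v, f v)) ` V) v = {(v, f v)}" using v by (auto simp: fib_def)
      then show "card (fib ((\<lambda>v. (v, f v)) ` V) v) = 1" by simp
    qed auto
    show "?L \<subseteq> ?R"
    proof
      fix S assume S: "S \<in> ?L"
      define f where "f = (\<lambda>v\<in>V. snd (the_elem (fib S v)))"
      have fib: "fib S v = {(v, f v)}" if "v \<in> V" for v
      proof -
        have "card (fib S v) = 1" using S that by blast
        then obtain x where x: "fib S v = {x}" by (rule card_1_singletonE)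
        then have "fst x = v" unfolding fib_def by auto
        then show ?thesis using x that by (cases x) (simp add: f_def)
      qed
      have "S = (\<lambda>v. (v, f v)) ` V"
      proof (intro equalityI subsetI)
        fix x assume x: "x \<in> S"
        then have "fst x \<in> V" using S by auto
        moreover have "x \<in> fib S (fst x)" using x by (simp add: fib_def)
        ultimately show "x \<in> (\<lambda>v. (v, f v)) ` V" using fib by auto
      next
        fix x assume "x \<in> (\<lambda>v. (v, f v)) ` V"
        then obtain v where "v \<in> V" "x = (v, f v)" by auto
        then have "x \<in> fib S v" using fib by simp
        then show "x \<in> S" by (simp add: fib_def)
      qed
      moreover have "f \<in> V \<rightarrow>\<^sub>E I"
      proof (rule PiE_I)
        fix v assume "v \<in> V"
        then have "(v, f v) \<in> fib S v" using fib by simp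
        then show "f v \<in> I" using S by (auto simp: fib_def)
      qed (simp add: f_def)
      ultimately show "S \<in> ?R" by blast
    qed
  qed
  have inj: "inj_on (\<lambda>f. (\<lambda>v. (v, f v)) ` V) (V \<rightarrow>\<^sub>E I)"
  proof (rule inj_onI)
    fix f g assume fg: "f \<in> V \<rightarrow>\<^sub>E I" "g \<in> V \<rightarrow>\<^sub>E I" and eq: "(\<lambda>v. (v, f v)) ` V = (\<lambda>v. (v, g v)) ` V"
    have "f v = g v" if "v \<in> V" for v
    proof -
      have "(v, f v) \<in> (\<lambda>v. (v, g v)) ` V" unfolding eq[symmetric] using that by blast
      then show ?thesis by auto
    qed
    then show "f = g" using fg by (auto intro: PiE_ext)
  qed
  \<comment> \<open>The sum over \<open>\<zeta>\<close> factors over the vertices, so the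
    one-variable filter applies to each fibre size.\<close>
  have filter: "(\<Sum>\<zeta>\<in>V \<rightarrow>\<^sub>E {..<Suc N}. (\<Prod>v\<in>V. (\<omega> ^ \<zeta> v) ^ N) * (\<Prod>x\<in>S. \<omega> ^ \<zeta> (fst x))) =
      (if \<forall>v\<in>V. card (fib S v) = 1 then of_nat (Suc N) ^ card V else 0)"
    if S: "S \<subseteq> V \<times> I" for S
  proof -
    have "(\<Sum>\<zeta>\<in>V \<rightarrow>\<^sub>E {..<Suc N}. (\<Prod>v\<in>V. (\<omega> ^ \<zeta> v) ^ N) * (\<Prod>x\<in>S. \<omega> ^ \<zeta> (fst x))) =
        (\<Sum>\<zeta>\<in>V \<rightarrow>\<^sub>E {..<Suc N}. \<Prod>v\<in>V. (\<omega> ^ \<zeta> v) ^ (N + card (fib S v)))"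
      unfolding group[OF S, of "\<lambda>v. \<omega> ^ _ v"] by (simp add: power_add prod.distrib)
    also have "\<dots> = (\<Prod>v\<in>V. \<Sum>s<Suc N. (\<omega> ^ s) ^ (N + card (fib S v)))"
      using assms by (subst prod_sum_PiE) auto
    also have "\<dots> = (\<Prod>v\<in>V. if card (fib S v) = 1 then of_nat (Suc N) else 0)"
      unfolding \<omega>_def using N fib_card[OF S] by (intro prod.cong refl root_of_unity_filter) auto
    also have "\<dots> = (if \<forall>v\<in>V. card (fib S v) = 1 then of_nat (Suc N) ^ card V else 0)"
      using assms by auto
    finally show ?thesis .
  qed
  have "(\<Sum>\<zeta>\<in>V \<rightarrow>\<^sub>E {..<Suc N}. (\<Prod>v\<in>V. (\<omega> ^ \<zeta> v) ^ N) *
      (\<Sum>S\<in>Pow (V \<times> I). (\<Prod>x\<in>S. \<omega> ^ \<zeta> (fst x)) * D S)) =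
    (\<Sum>S\<in>Pow (V \<times> I). (\<Sum>\<zeta>\<in>V \<rightarrow>\<^sub>E {..<Suc N}.
      (\<Prod>v\<in>V. (\<omega> ^ \<zeta> v) ^ N) * (\<Prod>x\<in>S. \<omega> ^ \<zeta> (fst x))) * D S)"
    unfolding sum_distrib_left sum_distrib_right mult.assoc by (rule sum.swap)
  also have "\<dots> = (\<Sum>S\<in>Pow (V \<times> I). if \<forall>v\<in>V. card (fib S v) = 1 then of_nat (Suc N) ^ card V * D S else 0)"
    by (intro sum.cong refl) (subst filter, auto)
  also have "\<dots> = (\<Sum>S | S \<in> Pow (V \<times> I) \<and> (\<forall>v\<in>V. card (fib S v) = 1). of_nat (Suc N) ^ card V * D S)"
    using assms by (subst sum.inter_filter) auto
  also have "\<dots> = of_nat (Suc N) ^ card V * (\<Sum>f\<in>V \<rightarrow>\<^sub>E I. D ((\<lambda>v. (v, f v)) ` V))"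
    unfolding transversal by (simp add: sum.reindex[OF inj] sum_distrib_left)
  finally show ?thesis .
qed

text \<open>The sum of minors is the multilinear coefficient of the determinant of
  \<open>1 + Z B\<close>, with \<open>Z\<close> diagonal and one variable per vertex. Up to scaling
  it is therefore an average, with weights of modulus 1, of determinants at roots of unity.\<close>

lemma transversal_minor_sum_le:
  fixes B :: "'a \<times> 'i \<Rightarrow> 'a \<times> 'i \<Rightarrow> real"
  assumes fin: "finite V" "finite I" and N: "card I = N" "N \<ge> 1" and "d > 0"
    and diag: "\<And>x. x \<in> V \<times> I \<Longrightarrow> B x x = 0"
    and row: "\<And>x. x \<in> V \<times> I \<Longrightarrow> (\<Sum>y\<in>V \<times> I. (B x y)\<^sup>2) \<le> d"
  shows "(\<Sum>f\<in>V \<rightarrow>\<^sub>E I. \<Sum>p | p permutes V. of_int (sign p) * (\<Prod>v\<in>V. B (v, f v) (p v, f (p v))))\<^sup>2 \<le>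
    (exp 1 * d * real N) ^ card V"
proof -
  let ?X = "V \<times> I" and ?n = "card V"
  define \<omega> where "\<omega> = exp (2 * complex_of_real pi * \<i> / complex_of_nat (Suc N))"
  \<comment> \<open>With this scale a row of \<open>\<rho> * B\<close> has squared norm at most
    \<open>1 / N\<close>. The \<open>N * card V\<close> rows then give the bound
    \<open>(1 + 1 / N) ^ (N * card V) \<le> exp 1 ^ card V\<close>.\<close>
  define \<rho> where "\<rho> = sqrt (1 / (d * real N))"
  define P where "P = (\<Sum>f\<in>V \<rightarrow>\<^sub>E I. \<Sum>p | p permutes V. of_int (sign p) * (\<Prod>v\<in>V. B (v, f v) (p v, f (p v))))"
  define D where "D S = complex_of_real (\<Sum>p | p permutes S. of_int (sign p) * (\<Prod>x\<in>S. \<rho> * B x (p x)))"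
    for S
  define F where "F \<zeta> = (\<Sum>p | p permutes ?X. of_int (sign p) *
      (\<Prod>x\<in>?X. \<omega> ^ \<zeta> (fst x) * of_real (\<rho> * B x (p x)) + of_bool (p x = x)))" for \<zeta> :: "'a \<Rightarrow> nat"
  have \<rho>2: "\<rho>\<^sup>2 = 1 / (d * real N)" using \<open>d > 0\<close> N by (simp add: \<rho>_def)
  have norm\<omega>: "cmod (\<omega> ^ j) = 1" for j
    by (simp add: \<omega>_def norm_power norm_exp_eq_Re)
  have F: "F \<zeta> = (\<Sum>S\<in>Pow ?X. (\<Prod>x\<in>S. \<omega> ^ \<zeta> (fst x)) * D S)" for \<zeta>
    unfolding F_def using fin
    by (subst sum_permutes_diagonal_expand) (auto simp: D_def prod.distrib sum_distrib_left mult_ac intro!: sum.cong)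
  have Dtrans: "D ((\<lambda>v. (v, f v)) ` V) = of_real (\<rho> ^ ?n *
      (\<Sum>p | p permutes V. of_int (sign p) * (\<Prod>v\<in>V. B (v, f v) (p v, f (p v)))))" for f
  proof -
    have "bij_betw (\<lambda>v. (v, f v)) V ((\<lambda>v. (v, f v)) ` V)" by (auto simp: bij_betw_def inj_on_def)
    from sum_permutes_reindex[OF this \<open>finite V\<close>, of "\<lambda>x y. \<rho> * B x y"] show ?thesis
      by (simp add: D_def prod.distrib sum_distrib_left mult_ac)
  qed
  have "of_nat (Suc N) ^ ?n * complex_of_real (\<rho> ^ ?n * P) =
      of_nat (Suc N) ^ ?n * (\<Sum>f\<in>V \<rightarrow>\<^sub>E I. D ((\<lambda>v. (v, f v)) ` V))"
    unfolding Dtrans P_def by (simp add: sum_distrib_left)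
  also have "\<dots> = (\<Sum>\<zeta>\<in>V \<rightarrow>\<^sub>E {..<Suc N}. (\<Prod>v\<in>V. (\<omega> ^ \<zeta> v) ^ N) * F \<zeta>)"
    unfolding F \<omega>_def using fin N by (rule multilinear_coefficient[symmetric])
  finally have eq: "of_nat (Suc N) ^ ?n * complex_of_real (\<rho> ^ ?n * P) =
      (\<Sum>\<zeta>\<in>V \<rightarrow>\<^sub>E {..<Suc N}. (\<Prod>v\<in>V. (\<omega> ^ \<zeta> v) ^ N) * F \<zeta>)" .
  have Fle: "(cmod (F \<zeta>))\<^sup>2 \<le> exp 1 ^ ?n" for \<zeta>
  proof -
    let ?M = "\<lambda>x y. \<omega> ^ \<zeta> (fst x) * of_real (\<rho> * B x y) + of_bool (y = x)"
    have "(cmod (F \<zeta>))\<^sup>2 \<le> (1 + 1 / real N) ^ card ?X"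
      unfolding F_def
    proof (rule signed_sum_permutes_norm_le)
      have "(\<Sum>y\<in>?X. (cmod (?M x y))\<^sup>2) \<le> 1 + 1 / real N" if x: "x \<in> ?X" for x
      proof -
        \<comment> \<open>The zero diagonal of \<open>B\<close> keeps the identity entry apart, so
          there is no cross term.\<close>
        have "(cmod (?M x y))\<^sup>2 = of_bool (y = x) + \<rho>\<^sup>2 * (B x y)\<^sup>2" for y
          using diag[OF x] norm\<omega> by (cases "y = x") (auto simp: norm_mult power_mult_distrib)
        then have "(\<Sum>y\<in>?X. (cmod (?M x y))\<^sup>2) = (\<Sum>y\<in>?X. of_bool (y = x)) + \<rho>\<^sup>2 * (\<Sum>y\<in>?X. (B x y)\<^sup>2)"
          by (simp add: sum.distrib sum_distrib_left)
        also have "(\<Sum>y\<in>?X. of_bool (y = x)) = (1 :: real)"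
          using fin x by (simp add: of_bool_def)
        also have "1 + \<rho>\<^sup>2 * (\<Sum>y\<in>?X. (B x y)\<^sup>2) \<le> 1 + \<rho>\<^sup>2 * d"
          using row[OF x] by (intro add_left_mono mult_left_mono) auto
        also have "\<rho>\<^sup>2 * d = 1 / real N" using \<open>d > 0\<close> by (simp add: \<rho>2)
        finally show ?thesis .
      qed
      then show "(\<Sum>x\<in>?X. \<Sum>y\<in>?X. (cmod (?M x y))\<^sup>2) \<le> real (card ?X) * (1 + 1 / real N)"
        by (rule sum_bounded_above)
    qed (use fin in auto)
    also have "card ?X = N * ?n" using N by (simp add: card_cartesian_product mult.commute)
    also have "(1 + 1 / real N) ^ (N * ?n) = ((1 + 1 / real N) ^ N) ^ ?n" by (rule power_mult)
    also have "\<dots> \<le> exp 1 ^ ?n"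
    proof (rule power_mono)
      have "(1 + 1 / real N) ^ N \<le> exp (1 / real N) ^ N"
        by (intro power_mono exp_ge_add_one_self) auto
      also have "\<dots> = exp 1" using N by (simp flip: exp_of_nat_mult)
      finally show "(1 + 1 / real N) ^ N \<le> exp 1" .
    qed auto
    finally show ?thesis .
  qed
  have "real (Suc N) ^ ?n * \<bar>\<rho> ^ ?n * P\<bar> =
      cmod (\<Sum>\<zeta>\<in>V \<rightarrow>\<^sub>E {..<Suc N}. (\<Prod>v\<in>V. (\<omega> ^ \<zeta> v) ^ N) * F \<zeta>)"
    unfolding eq[symmetric] norm_mult norm_of_real norm_power norm_of_nat by simp
  also have "\<dots> \<le> (\<Sum>\<zeta>\<in>V \<rightarrow>\<^sub>E {..<Suc N}. sqrt (exp 1 ^ ?n))"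
  proof (rule sum_norm_le)
    fix \<zeta>
    have "cmod ((\<Prod>v\<in>V. (\<omega> ^ \<zeta> v) ^ N) * F \<zeta>) = cmod (F \<zeta>)"
      by (simp add: norm_mult prod_norm[symmetric] norm\<omega> norm_power[of "\<omega> ^ _"])
    also have "\<dots> \<le> sqrt (exp 1 ^ ?n)" using Fle by (rule real_le_rsqrt)
    finally show "cmod ((\<Prod>v\<in>V. (\<omega> ^ \<zeta> v) ^ N) * F \<zeta>) \<le> sqrt (exp 1 ^ ?n)" .
  qed
  also have "\<dots> = real (Suc N) ^ ?n * sqrt (exp 1 ^ ?n)"
    using fin by (simp add: card_PiE)
  finally have "\<bar>\<rho> ^ ?n * P\<bar> \<le> sqrt (exp 1 ^ ?n)"
    by (subst (asm) mult_le_cancel_left_pos) auto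
  then have "\<bar>\<rho> ^ ?n * P\<bar>\<^sup>2 \<le> (sqrt (exp 1 ^ ?n))\<^sup>2" by (intro power_mono) auto
  then have "(\<rho>\<^sup>2) ^ ?n * P\<^sup>2 \<le> exp 1 ^ ?n"
    by (simp add: power_mult_distrib flip: power_mult) (simp add: mult.commute)
  then have "P\<^sup>2 \<le> exp 1 ^ ?n * (d * real N) ^ ?n"
    using \<open>d > 0\<close> N by (simp add: \<rho>2 power_divide divide_le_eq)
  then show ?thesis by (simp add: P_def power_mult_distrib mult.assoc)
qed

section \<open>Cycles of permutations and the regular representation\<close>

lemma sum_PiE_insert:
  assumes "u \<notin> S"
  shows "(\<Sum>f\<in>insert u S \<rightarrow>\<^sub>E I. F f) = (\<Sum>a\<in>I. \<Sum>f\<in>S \<rightarrow>\<^sub>E I. F (f(u := a)))"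
proof -
  have "(\<Sum>f\<in>insert u S \<rightarrow>\<^sub>E I. F f) = (\<Sum>(a, f)\<in>I \<times> (S \<rightarrow>\<^sub>E I). F (f(u := a)))"
    unfolding PiE_insert_eq
    by (subst sum.reindex[OF inj_combinator[OF assms]]) (simp add: case_prod_unfold)
  then show ?thesis by (simp add: sum.cartesian_product)
qed

text \<open>\<open>F\<close> sees only the values on \<open>A\<close>, and \<open>G\<close> only
  those on \<open>B\<close>. This factors a sum over states of all vertices into sums over single
  cycles.\<close>

lemma sum_PiE_Un_mult:
  fixes F :: "_ \<Rightarrow> 'c :: comm_semiring_0"
  assumes "finite A" and "A \<inter> B = {}"
    and F: "\<And>f g. (\<And>v. v \<in> A \<Longrightarrow> f v = g v) \<Longrightarrow> F f = F g"
    and G: "\<And>f g. (\<And>v. v \<in> B \<Longrightarrow> f v = g v) \<Longrightarrow> G f = G g"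
  shows "(\<Sum>f\<in>A \<union> B \<rightarrow>\<^sub>E I. F f * G f) = (\<Sum>f\<in>A \<rightarrow>\<^sub>E I. F f) * (\<Sum>f\<in>B \<rightarrow>\<^sub>E I. G f)"
  using assms
proof (induction A arbitrary: F rule: finite_induct)
  case empty
  have "(\<Sum>f\<in>B \<rightarrow>\<^sub>E I. F f * G f) = (\<Sum>f\<in>B \<rightarrow>\<^sub>E I. F (\<lambda>_. undefined) * G f)"
  proof (rule sum.cong[OF refl])
    fix f
    have "F f = F (\<lambda>_. undefined)" by (rule empty.prems(2)) simp
    then show "F f * G f = F (\<lambda>_. undefined) * G f" by simp
  qed
  then show ?case by (simp add: sum_distrib_left)
next
  case (insert u A)
  have "(\<Sum>f\<in>insert u (A \<union> B) \<rightarrow>\<^sub>E I. F f * G f) =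
      (\<Sum>a\<in>I. \<Sum>f\<in>A \<union> B \<rightarrow>\<^sub>E I. F (f(u := a)) * G (f(u := a)))"
    using insert.hyps insert.prems(1) by (intro sum_PiE_insert) auto
  also have "\<dots> = (\<Sum>a\<in>I. \<Sum>f\<in>A \<union> B \<rightarrow>\<^sub>E I. F (f(u := a)) * G f)"
  proof (intro sum.cong refl)
    fix a f
    have "G (f(u := a)) = G f" by (rule insert.prems(3)) (use insert.prems(1) in auto)
    then show "F (f(u := a)) * G (f(u := a)) = F (f(u := a)) * G f" by simp
  qed
  also have "\<dots> = (\<Sum>a\<in>I. (\<Sum>f\<in>A \<rightarrow>\<^sub>E I. F (f(u := a))) * (\<Sum>f\<in>B \<rightarrow>\<^sub>E I. G f))"
  proof (rule sum.cong[OF refl])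
    fix a
    show "(\<Sum>f\<in>A \<union> B \<rightarrow>\<^sub>E I. F (f(u := a)) * G f) =
        (\<Sum>f\<in>A \<rightarrow>\<^sub>E I. F (f(u := a))) * (\<Sum>f\<in>B \<rightarrow>\<^sub>E I. G f)"
    proof (rule insert.IH[of "\<lambda>f. F (f(u := a))"])
      show "F (f(u := a)) = F (g(u := a))" if "\<And>v. v \<in> A \<Longrightarrow> f v = g v" for f g
        by (rule insert.prems(2)) (use that in auto)
      show "A \<inter> B = {}" using insert.prems(1) by auto
    qed (rule insert.prems(3))
  qed
  also have "\<dots> = (\<Sum>f\<in>insert u A \<rightarrow>\<^sub>E I. F f) * (\<Sum>f\<in>B \<rightarrow>\<^sub>E I. G f)"
    using insert.hyps by (simp add: sum_PiE_insert sum_distrib_right)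
  finally show ?case by simp
qed

text \<open>\<open>us @ [v]\<close> is \<open>v # us\<close> rotated by one place, so zipping the
  two lists the consecutive pairs, closing pair included.\<close>

lemma cycle_of_list_prod:
  assumes "distinct (v # us)"
  shows "(\<Prod>y\<in>set (v # us). h y (cycle_of_list (v # us) y)) = prod_list (map2 h (v # us) (us @ [v]))"
proof -
  let ?c = "cycle_of_list (v # us)"
  have rot: "map ?c (v # us) = us @ [v]"
    using cyclic_rotation[OF assms, of 1] by simp
  have "map2 h xs (map ?c xs) = map (\<lambda>y. h y (?c y)) xs" for xs
    by (induction xs) auto
  from this[of "v # us"] show ?thesis
    by (simp only: prod.distinct_set_conv_list[OF assms] rot)
qed

lemma sign_cycle_of_list: "distinct (v # us) \<Longrightarrow> sign (cycle_of_list (v # us)) = (-1) ^ length us"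
proof (induction us arbitrary: v)
  case (Cons u us)
  have "v \<noteq> u" using Cons.prems by auto
  then have "sign (Transposition.transpose v u) = - 1" by (simp add: sign_swap_id)
  moreover have "sign (cycle_of_list (u # us)) = (-1) ^ length us" using Cons by simp
  moreover have "sign (Transposition.transpose v u \<circ> cycle_of_list (u # us)) =
      sign (Transposition.transpose v u) * sign (cycle_of_list (u # us))"
    by (intro sign_compose permutation_swap_id permutation_of_cycle)
  ultimately show ?case by (simp only: cycle_of_list.simps length_Cons power_Suc)
qed simp

lemma cycle_decomp_permutes: "cycle_decomp S p \<Longrightarrow> p permutes S"
proof (induction rule: cycle_decomp.induct)
  case (comp S p cs)
  have "cycle_of_list cs permutes set cs \<union> S"
    using cycle_permutes by (rule permutes_subset) auto
  moreover have "p permutes set cs \<union> S"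
    using comp.IH by (rule permutes_subset) auto
  ultimately show ?case by (intro permutes_compose)
qed (rule permutes_id)

text \<open>
  The regular representation with multiplicity \<open>j\<close>, compressed to the orthogonal complement of
  the all-one vector.
\<close>

definition reg_act :: "('g, 'm) monoid_scheme \<Rightarrow> 'g \<Rightarrow> 'g \<times> nat \<Rightarrow> 'g \<times> nat" where
  "reg_act \<Gamma> h x = (fst x \<otimes>\<^bsub>\<Gamma>\<^esub> h, snd x)"

definition reg_index :: "('g, 'm) monoid_scheme \<Rightarrow> nat \<Rightarrow> ('g \<times> nat) set" where
  "reg_index \<Gamma> j = carrier \<Gamma> \<times> {..<j}"

definition reg_rep :: "('g, 'm) monoid_scheme \<Rightarrow> nat \<Rightarrow> 'g \<Rightarrow> 'g \<times> nat \<Rightarrow> 'g \<times> nat \<Rightarrow> real" where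
  "reg_rep \<Gamma> j h x y = of_bool (y = reg_act \<Gamma> h x) - 1 / real (order \<Gamma> * j)"

lemma finite_reg_index: "finite (carrier \<Gamma>) \<Longrightarrow> finite (reg_index \<Gamma> j)"
  by (simp add: reg_index_def)

lemma card_reg_index: "card (reg_index \<Gamma> j) = order \<Gamma> * j"
  by (simp add: reg_index_def Coset.order_def card_cartesian_product)

section \<open>The compressed regular representation: products, trace and row norms\<close>

context group
begin

lemma reg_act_closed: "h \<in> carrier G \<Longrightarrow> x \<in> reg_index G j \<Longrightarrow> reg_act G h x \<in> reg_index G j"
  by (auto simp: reg_act_def reg_index_def)

text \<open>Acting by right multiplication composes in the order in which labels are multiplied
  along a walk, which matters for nonabelian groups.\<close>

lemma reg_act_mult:
  "h \<in> carrier G \<Longrightarrow> h' \<in> carrier G \<Longrightarrow> x \<in> reg_index G j \<Longrightarrow>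
     reg_act G h' (reg_act G h x) = reg_act G (h \<otimes> h') x"
  by (auto simp: reg_act_def reg_index_def m_assoc)

lemma reg_index_order_pos:
  assumes "finite (carrier G)" and "x \<in> reg_index G j"
  shows "real (order G * j) > 0"
  using assms order_gt_0_iff_finite by (auto simp: reg_index_def)

text \<open>A row of the representation evaluates at the translate and subtracts the mean.\<close>

lemma sum_reg_rep_left:
  assumes fin: "finite (carrier G)" and h: "h \<in> carrier G" and x: "x \<in> reg_index G j"
  shows "(\<Sum>y\<in>reg_index G j. reg_rep G j h x y * F y) =
    F (reg_act G h x) - (\<Sum>y\<in>reg_index G j. F y) / real (order G * j)"
proof -
  have "(\<Sum>y\<in>reg_index G j. of_bool (y = reg_act G h x) * F y) =
      (\<Sum>y\<in>reg_index G j. if y = reg_act G h x then F y else 0)"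
    by (intro sum.cong) auto
  also have "\<dots> = F (reg_act G h x)"
    using finite_reg_index[OF fin, of j] reg_act_closed[OF h x] by simp
  finally have "(\<Sum>y\<in>reg_index G j. of_bool (y = reg_act G h x) * F y) = F (reg_act G h x)" .
  then show ?thesis
    by (simp add: reg_rep_def left_diff_distrib sum_subtractf sum_divide_distrib)
qed

lemma sum_reg_rep_col:
  assumes fin: "finite (carrier G)" and h: "h \<in> carrier G" and z: "z \<in> reg_index G j"
  shows "(\<Sum>y\<in>reg_index G j. reg_rep G j h y z) = 0"
proof -
  let ?y = "reg_act G (inv h) z"
  have y: "?y \<in> reg_index G j" using h z by (intro reg_act_closed) auto
  have "z = reg_act G h y \<longleftrightarrow> y = ?y" if "y \<in> reg_index G j" for y
  proof
    assume "z = reg_act G h y"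
    then show "y = ?y" using h that reg_act_mult[of h "inv h" y j]
      by (auto simp: reg_act_def reg_index_def)
  next
    assume "y = ?y"
    then show "z = reg_act G h y" using h z reg_act_mult[of "inv h" h z j]
      by (auto simp: reg_act_def reg_index_def)
  qed
  then have "(\<Sum>y\<in>reg_index G j. of_bool (z = reg_act G h y)) =
      (\<Sum>y\<in>reg_index G j. of_bool (y = ?y) :: real)"
    by (intro sum.cong) auto
  also have "\<dots> = 1"
    using finite_reg_index[OF fin] y by (simp add: of_bool_def)
  finally show ?thesis
    using reg_index_order_pos[OF fin z] by (simp add: reg_rep_def sum_subtractf card_reg_index del: of_nat_mult)
qed

text \<open>The mean over the middle index vanishes because column sums are 0, so the translations
  stay multiplicative after compression.\<close>

lemma reg_rep_mult:
  assumes "finite (carrier G)" and "h \<in> carrier G" "h' \<in> carrier G"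
    and "x \<in> reg_index G j" "z \<in> reg_index G j"
  shows "(\<Sum>y\<in>reg_index G j. reg_rep G j h x y * reg_rep G j h' y z) = reg_rep G j (h \<otimes> h') x z"
  using assms by (simp add: sum_reg_rep_left sum_reg_rep_col) (simp add: reg_rep_def reg_act_mult)

text \<open>Translation by the identity fixes every index and any other translation fixes none; the
  subtracted projection has trace 1.\<close>

lemma reg_rep_trace:
  assumes "finite (carrier G)" and "h \<in> carrier G" and "j \<ge> 1"
  shows "(\<Sum>x\<in>reg_index G j. reg_rep G j h x x) = (if h = \<one> then real (order G * j) - 1 else - 1)"
proof -
  have "x = reg_act G h x \<longleftrightarrow> h = \<one>" if "x \<in> reg_index G j" for x
    using that assms by (cases x) (auto simp: reg_act_def reg_index_def)
  then have "(\<Sum>x\<in>reg_index G j. reg_rep G j h x x) =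
      (\<Sum>x\<in>reg_index G j. of_bool (h = \<one>) - 1 / real (order G * j))"
    unfolding reg_rep_def by (intro sum.cong) auto
  also have "\<dots> = (if h = \<one> then real (order G * j) - 1 else - 1)"
    using assms order_gt_0_iff_finite by (simp add: card_reg_index sum_subtractf right_diff_distrib)
  finally show ?thesis .
qed

text \<open>Row sums are 0, so the sum of squares collapses to the single entry at
  \<open>reg_act G h x\<close>.\<close>

lemma reg_rep_row_square:
  assumes "finite (carrier G)" and "h \<in> carrier G" and x: "x \<in> reg_index G j"
  shows "(\<Sum>y\<in>reg_index G j. (reg_rep G j h x y)\<^sup>2) \<le> 1"
proof -
  have "(\<Sum>y\<in>reg_index G j. reg_rep G j h x y) = 0"
    using sum_reg_rep_left[OF assms, of "\<lambda>_. 1"] reg_index_order_pos[OF assms(1) x]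
    by (simp add: card_reg_index del: of_nat_mult)
  then have "(\<Sum>y\<in>reg_index G j. (reg_rep G j h x y)\<^sup>2) = reg_rep G j h x (reg_act G h x)"
    using sum_reg_rep_left[OF assms, of "reg_rep G j h x"] by (simp add: power2_eq_square)
  also have "\<dots> \<le> 1" by (simp add: reg_rep_def)
  finally show ?thesis .
qed

end

section \<open>State sums along walks and cycles of a labelled digraph\<close>

locale labelled_digraph = digraph D + \<Gamma>: group \<Gamma>
  for D :: "('a, 'b) pre_digraph" and \<Gamma> :: "('g, 'm) monoid_scheme" +
  fixes w :: "'b \<Rightarrow> 'g"
  assumes finite_group: "finite (carrier \<Gamma>)" and label_closed: "w \<in> arcs D \<rightarrow> carrier \<Gamma>"
begin

definition adj :: "'a \<Rightarrow> 'a \<Rightarrow> bool" where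
  "adj u v \<longleftrightarrow> (\<exists>e\<in>arcs D. tail D e = u \<and> head D e = v)"

text \<open>For adjacent vertices the choice is unique, as there are no parallel arcs.\<close>

definition arc_between :: "'a \<Rightarrow> 'a \<Rightarrow> 'b" where
  "arc_between u v = (SOME e. e \<in> arcs D \<and> tail D e = u \<and> head D e = v)"

lemma arc_between:
  assumes "adj u v"
  shows "arc_between u v \<in> arcs D" "tail D (arc_between u v) = u" "head D (arc_between u v) = v"
proof -
  have "\<exists>e. e \<in> arcs D \<and> tail D e = u \<and> head D e = v" using assms by (auto simp: adj_def)
  from someI_ex[OF this] show "arc_between u v \<in> arcs D" "tail D (arc_between u v) = u"
    "head D (arc_between u v) = v" by (auto simp: arc_between_def)
qed

lemma adj_in_verts: "adj u v \<Longrightarrow> u \<in> verts D \<and> v \<in> verts D"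
  by (auto simp: adj_def)

lemma not_adj_self: "\<not> adj v v"
  using no_loops unfolding adj_def by metis

text \<open>Without an arc from \<open>u\<close> to \<open>v\<close> the value is arbitrary; a
  factor \<open>of_bool (adj u v)\<close> masks it wherever all pairs occur.\<close>

definition trans_rep :: "nat \<Rightarrow> 'a \<Rightarrow> 'a \<Rightarrow> 'g \<times> nat \<Rightarrow> 'g \<times> nat \<Rightarrow> real" where
  "trans_rep j u v = reg_rep \<Gamma> j (w (arc_between u v))"

lemma label_arc_between: "adj u v \<Longrightarrow> w (arc_between u v) \<in> carrier \<Gamma>"
  using arc_between label_closed by auto

lemma label_product_path:
  assumes "\<And>a b. (a, b) \<in> set (zip xs ys) \<Longrightarrow> adj a b"
  shows "label_product \<Gamma> w (map2 arc_between xs ys) \<in> carrier \<Gamma>"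
  using assms label_arc_between by (intro \<Gamma>.label_product_closed) auto

text \<open>Summing out the states of inner vertices multiplies matrices along the path, and
  multiplicativity yields the representation of the ordered label product. \<open>g\<close> holds
  the states of the end points.\<close>

lemma sum_path_trans_rep:
  assumes "distinct us" "x \<notin> set us" "z \<notin> set us"
    and "\<And>a b. (a, b) \<in> set (zip (x # us) (us @ [z])) \<Longrightarrow> adj a b"
    and "g x \<in> reg_index \<Gamma> j" "g z \<in> reg_index \<Gamma> j"
  shows "(\<Sum>f\<in>set us \<rightarrow>\<^sub>E reg_index \<Gamma> j. prod_list (map2
      (\<lambda>a b. trans_rep j a b (if a \<in> set us then f a else g a) (if b \<in> set us then f b else g b))
      (x # us) (us @ [z]))) =
    reg_rep \<Gamma> j (label_product \<Gamma> w (map2 arc_between (x # us) (us @ [z]))) (g x) (g z)"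
  using assms
proof (induction us arbitrary: x g)
  case Nil
  then have "adj x z" by simp
  then show ?case
    using label_arc_between by (simp add: trans_rep_def label_product_def)
next
  case (Cons u us)
  let ?I = "reg_index \<Gamma> j"
  let ?ov = "\<lambda>S f g a. if a \<in> S then f a else g a"
  let ?L = "label_product \<Gamma> w (map2 arc_between (u # us) (us @ [z]))"
  have adj: "adj x u" "\<And>a b. (a, b) \<in> set (zip (u # us) (us @ [z])) \<Longrightarrow> adj a b"
    using Cons.prems(4) by auto
  \<comment> \<open>Moving the state \<open>y\<close> of \<open>u\<close> from \<open>f\<close> into
    \<open>g\<close> makes \<open>u\<close> the start of the shorter path.\<close>
  have inner: "(\<Sum>f\<in>set us \<rightarrow>\<^sub>E ?I. prod_list (map2
      (\<lambda>a b. trans_rep j a b (?ov (set (u # us)) (f(u := y)) g a) (?ov (set (u # us)) (f(u := y)) g b))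
      (u # us) (us @ [z]))) = reg_rep \<Gamma> j ?L y (g z)" if y: "y \<in> ?I" for y
  proof -
    have "(\<Sum>f\<in>set us \<rightarrow>\<^sub>E ?I. prod_list (map2
        (\<lambda>a b. trans_rep j a b (?ov (set us) f (g(u := y)) a) (?ov (set us) f (g(u := y)) b))
        (u # us) (us @ [z]))) = reg_rep \<Gamma> j ?L ((g(u := y)) u) ((g(u := y)) z)"
      using Cons.prems y adj by (intro Cons.IH) auto
    moreover have eq: "?ov (set (u # us)) (f(u := y)) g a = ?ov (set us) f (g(u := y)) a" for f a
      using Cons.prems by auto
    moreover have z: "(g(u := y)) z = g z" using Cons.prems by auto
    ultimately show ?thesis by (simp only: eq fun_upd_same z)
  qed
  let ?h = "\<lambda>f a b. trans_rep j a b (?ov (set (u # us)) f g a) (?ov (set (u # us)) f g b)"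
  let ?\<Phi> = "\<lambda>f. prod_list (map2 (?h f) (x # u # us) ((u # us) @ [z]))"
  let ?\<Psi> = "\<lambda>f. prod_list (map2 (?h f) (u # us) (us @ [z]))"
  have split: "?\<Phi> f = ?h f x u * ?\<Psi> f" for f
    by (simp only: append_Cons zip_Cons_Cons list.map prod.case prod_list.Cons)
  have u: "u \<notin> set us" and x: "x \<notin> set (u # us)" using Cons.prems by auto
  have h: "?h (f(u := y)) x u = trans_rep j x u (g x) y" for f y
    using x by simp
  have "(\<Sum>f\<in>set (u # us) \<rightarrow>\<^sub>E ?I. ?\<Phi> f) = (\<Sum>y\<in>?I. \<Sum>f\<in>set us \<rightarrow>\<^sub>E ?I. ?\<Phi> (f(u := y)))"
    using sum_PiE_insert[OF u, of ?\<Phi> ?I] by (simp only: list.set(2))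
  also have "\<dots> = (\<Sum>y\<in>?I. \<Sum>f\<in>set us \<rightarrow>\<^sub>E ?I. trans_rep j x u (g x) y * ?\<Psi> (f(u := y)))"
    unfolding split h ..
  also have "\<dots> = (\<Sum>y\<in>?I. trans_rep j x u (g x) y * reg_rep \<Gamma> j ?L y (g z))"
    unfolding sum_distrib_left[symmetric]
    by (intro sum.cong refl arg_cong2[of _ _ _ _ "(*)"] inner)
  also have "\<dots> = reg_rep \<Gamma> j (w (arc_between x u) \<otimes>\<^bsub>\<Gamma>\<^esub> ?L) (g x) (g z)"
    unfolding trans_rep_def using Cons.prems adj finite_group
    by (intro \<Gamma>.reg_rep_mult label_arc_between label_product_path) auto
  finally show ?case by (simp add: label_product_def)
qed

text \<open>Cutting the cycle at \<open>v\<close> gives a path whose two end states agree; summing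
  over that state takes a trace.\<close>

lemma sum_cycle_trans_rep:
  assumes dist: "distinct (v # us)" and "j \<ge> 1"
    and adj: "\<And>a b. (a, b) \<in> set (zip (v # us) (us @ [v])) \<Longrightarrow> adj a b"
  shows "(\<Sum>f\<in>set (v # us) \<rightarrow>\<^sub>E reg_index \<Gamma> j.
      \<Prod>y\<in>set (v # us). trans_rep j y (cycle_of_list (v # us) y) (f y) (f (cycle_of_list (v # us) y))) =
    (if zero_sum \<Gamma> w (map2 arc_between (v # us) (us @ [v])) then real (order \<Gamma> * j) - 1 else - 1)"
proof -
  let ?I = "reg_index \<Gamma> j"
  let ?L = "label_product \<Gamma> w (map2 arc_between (v # us) (us @ [v]))"
  let ?\<Phi> = "\<lambda>f. prod_list (map2 (\<lambda>a b. trans_rep j a b (f a) (f b)) (v # us) (us @ [v]))"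
  have v: "v \<notin> set us" "distinct us" using dist by auto
  have "(\<Sum>f\<in>set (v # us) \<rightarrow>\<^sub>E ?I.
      \<Prod>y\<in>set (v # us). trans_rep j y (cycle_of_list (v # us) y) (f y) (f (cycle_of_list (v # us) y))) =
    (\<Sum>f\<in>insert v (set us) \<rightarrow>\<^sub>E ?I. ?\<Phi> f)"
    unfolding cycle_of_list_prod[OF dist, of "\<lambda>a b. trans_rep j a b (_ a) (_ b)"] by (simp only: list.set)
  also have "\<dots> = (\<Sum>x\<in>?I. \<Sum>f\<in>set us \<rightarrow>\<^sub>E ?I. ?\<Phi> (f(v := x)))"
    by (rule sum_PiE_insert[OF v(1)])
  also have "\<dots> = (\<Sum>x\<in>?I. reg_rep \<Gamma> j ?L x x)"
  proof (rule sum.cong[OF refl])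
    fix x assume x: "x \<in> ?I"
    have "(\<Sum>f\<in>set us \<rightarrow>\<^sub>E ?I. ?\<Phi> (f(v := x))) = (\<Sum>f\<in>set us \<rightarrow>\<^sub>E ?I. prod_list (map2
        (\<lambda>a b. trans_rep j a b (if a \<in> set us then f a else x) (if b \<in> set us then f b else x))
        (v # us) (us @ [v])))"
    proof (rule sum.cong[OF refl], rule arg_cong[of _ _ prod_list], rule map_cong[OF refl])
      fix f e assume e: "e \<in> set (zip (v # us) (us @ [v]))"
      obtain a b where ab: "e = (a, b)" by (cases e)
      have "a \<in> insert v (set us)" "b \<in> insert v (set us)"
        using set_zip_leftD[of a b "v # us" "us @ [v]"] set_zip_rightD[of a b "v # us" "us @ [v]"] e
        unfolding ab by auto
      then show "(case e of (a, b) \<Rightarrow> trans_rep j a b ((f(v := x)) a) ((f(v := x)) b)) =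
          (case e of (a, b) \<Rightarrow>
            trans_rep j a b (if a \<in> set us then f a else x) (if b \<in> set us then f b else x))"
        using v unfolding ab by auto
    qed
    also have "\<dots> = reg_rep \<Gamma> j ?L x x"
      by (rule sum_path_trans_rep[OF v(2,1,1) adj, where g = "\<lambda>_. x"]) (use x in auto)
    finally show "(\<Sum>f\<in>set us \<rightarrow>\<^sub>E ?I. ?\<Phi> (f(v := x))) = reg_rep \<Gamma> j ?L x x" .
  qed
  also have "\<dots> = (if ?L = \<one>\<^bsub>\<Gamma>\<^esub> then real (order \<Gamma> * j) - 1 else - 1)"
    using finite_group label_product_path[OF adj] \<open>j \<ge> 1\<close> by (rule \<Gamma>.reg_rep_trace)
  finally show ?thesis by (simp only: zero_sum_def)
qed

lemma path_arc_between:
  assumes "\<And>a b. (a, b) \<in> set (zip (x # us) (us @ [z])) \<Longrightarrow> adj a b"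
  defines "p \<equiv> map2 arc_between (x # us) (us @ [z])"
  shows "awalk x p z" "awalk_verts x p = x # us @ [z]" "tail D ` set p = insert x (set us)"
proof -
  have "awalk x p z \<and> awalk_verts x p = x # us @ [z] \<and> tail D ` set p = insert x (set us)"
    using assms(1) unfolding p_def
  proof (induction us arbitrary: x)
    case Nil
    then have "adj x z" by simp
    then show ?case using arc_between[of x z] adj_in_verts[of x z] by (simp add: awalk_def)
  next
    case (Cons u us)
    let ?q = "map2 arc_between (u # us) (us @ [z])"
    have "adj x u" using Cons.prems by simp
    moreover have "awalk u ?q z \<and> awalk_verts u ?q = u # us @ [z] \<and> tail D ` set ?q = insert u (set us)"
      by (rule Cons.IH) (use Cons.prems in auto)
    ultimately show ?case
      using arc_between[of x u] by (simp add: awalk_Cons_iff)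
  qed
  then show "awalk x p z" "awalk_verts x p = x # us @ [z]" "tail D ` set p = insert x (set us)"
    by auto
qed

text \<open>A cycle of length \<open>l\<close> has sign \<open>(-1) ^ (l - 1)\<close> and state sum
  \<open>order \<Gamma> * j - 1\<close> or -1, so it contributes \<open>(-1) ^ l\<close> times
  \<open>1 - order \<Gamma> * j\<close> or 1. \<open>C\<close> is chosen before \<open>j\<close>, so
  one cover serves all multiplicities.\<close>

lemma permutation_cycle_cover:
  assumes "cycle_decomp S \<sigma>" and "finite S" and "\<And>v. v \<in> S \<Longrightarrow> adj v (\<sigma> v)"
  shows "\<exists>C. finite C \<and> (\<forall>p\<in>C. pre_digraph.cycle D p) \<and>
    pairwise (\<lambda>p q. disjnt (cycle_verts D p) (cycle_verts D q)) C \<and>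
    (\<Union>p\<in>C. cycle_verts D p) = S \<and>
    (\<forall>j\<ge>1. (\<Sum>f\<in>S \<rightarrow>\<^sub>E reg_index \<Gamma> j. \<Prod>v\<in>S. trans_rep j v (\<sigma> v) (f v) (f (\<sigma> v))) * of_int (sign \<sigma>) =
      (-1) ^ card S * (1 - real (order \<Gamma> * j)) ^ card {p \<in> C. zero_sum \<Gamma> w p})"
  using assms
proof (induction rule: cycle_decomp.induct)
  case empty
  show ?case by (intro exI[of _ "{}"]) (simp add: sign_id)
next
  case (comp S \<sigma> cs)
  show ?case
  proof (cases cs)
    \<comment> \<open>The decomposition may list an empty cycle, which changes neither
      \<open>S\<close> nor the permutation.\<close>
    case Nil
    then show ?thesis using comp by (simp add: id_def comp_def)
  next
    case (Cons v us)
    let ?c = "cycle_of_list cs"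
    let ?p = "map2 arc_between (v # us) (us @ [v])"
    have dist: "distinct (v # us)" using comp.hyps(2) Cons by simp
    have perm: "\<sigma> permutes S" using comp.hyps(1) by (rule cycle_decomp_permutes)
    have cperm: "?c permutes set cs" by (rule cycle_permutes)
    have finS: "finite S" using comp.prems by auto
    have onS: "(?c \<circ> \<sigma>) y = \<sigma> y" if "y \<in> S" for y
    proof -
      have "\<sigma> y \<in> S" using perm that by (simp add: permutes_in_image)
      then have "\<sigma> y \<notin> set cs" using comp.hyps(3) by auto
      then show ?thesis using cperm by (simp add: permutes_not_in)
    qed
    have oncs: "(?c \<circ> \<sigma>) y = ?c y" if "y \<in> set cs" for y
    proof -
      have "y \<notin> S" using comp.hyps(3) that by auto
      then show ?thesis using perm by (simp add: permutes_not_in)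
    qed
    have adjS: "adj y (\<sigma> y)" if "y \<in> S" for y
      using comp.prems(2)[of y] onS[OF that] that by simp
    have rot: "map ?c (v # us) = us @ [v]"
      using cyclic_rotation[OF comp.hyps(2), of 1] Cons by simp
    have adjc: "adj a b" if "(a, b) \<in> set (zip (v # us) (us @ [v]))" for a b
    proof -
      have "b = ?c a" "a \<in> set cs"
        using that unfolding rot[symmetric] Cons[symmetric] by (auto simp: set_zip)
      then show ?thesis using comp.prems(2)[of a] oncs[of a] by simp
    qed
    obtain C where C: "finite C" "\<forall>p\<in>C. pre_digraph.cycle D p"
        "pairwise (\<lambda>p q. disjnt (cycle_verts D p) (cycle_verts D q)) C"
        "(\<Union>p\<in>C. cycle_verts D p) = S"
        "\<And>j. j \<ge> 1 \<Longrightarrow> (\<Sum>f\<in>S \<rightarrow>\<^sub>E reg_index \<Gamma> j. \<Prod>v\<in>S. trans_rep j v (\<sigma> v) (f v) (f (\<sigma> v))) * of_int (sign \<sigma>) =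
           (-1) ^ card S * (1 - real (order \<Gamma> * j)) ^ card {p \<in> C. zero_sum \<Gamma> w p}"
      using comp.IH[OF finS adjS] by blast
    have pv: "cycle_verts D ?p = set cs"
      using path_arc_between(3)[OF adjc] Cons by (simp add: cycle_verts_def)
    have pcyc: "pre_digraph.cycle D ?p"
      unfolding cycle_def using path_arc_between(1,2)[OF adjc] dist by (intro exI[of _ v]) auto
    have disj: "disjnt (set cs) (cycle_verts D q)" if "q \<in> C" for q
      using that C(4) comp.hyps(3) by (auto simp: disjnt_def)
    have notin: "?p \<notin> C"
    proof
      assume "?p \<in> C"
      from disj[OF this] show False using Cons unfolding pv by (simp add: disjnt_def)
    qed
    have card_zs: "card {p \<in> insert ?p C. zero_sum \<Gamma> w p} =
        card {p \<in> C. zero_sum \<Gamma> w p} + (if zero_sum \<Gamma> w ?p then 1 else 0)"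
    proof -
      have "{p \<in> insert ?p C. zero_sum \<Gamma> w p} =
          (if zero_sum \<Gamma> w ?p then insert ?p {p \<in> C. zero_sum \<Gamma> w p} else {p \<in> C. zero_sum \<Gamma> w p})"
        by auto
      then show ?thesis using C(1) notin by simp
    qed
    have formula: "(\<Sum>f\<in>set cs \<union> S \<rightarrow>\<^sub>E reg_index \<Gamma> j.
        \<Prod>v\<in>set cs \<union> S. trans_rep j v ((?c \<circ> \<sigma>) v) (f v) (f ((?c \<circ> \<sigma>) v))) * of_int (sign (?c \<circ> \<sigma>)) =
      (-1) ^ card (set cs \<union> S) * (1 - real (order \<Gamma> * j)) ^ card {p \<in> insert ?p C. zero_sum \<Gamma> w p}"
      if j: "j \<ge> 1" for j
    proof -
      let ?I = "reg_index \<Gamma> j"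
      let ?F = "\<lambda>f. \<Prod>y\<in>set cs. trans_rep j y (?c y) (f y) (f (?c y))"
      let ?G = "\<lambda>f. \<Prod>y\<in>S. trans_rep j y (\<sigma> y) (f y) (f (\<sigma> y))"
      have "(\<Prod>v\<in>set cs \<union> S. trans_rep j v ((?c \<circ> \<sigma>) v) (f v) (f ((?c \<circ> \<sigma>) v))) = ?F f * ?G f" for f
        using finS comp.hyps(3) oncs onS by (simp add: prod.union_disjoint)
      then have "(\<Sum>f\<in>set cs \<union> S \<rightarrow>\<^sub>E ?I.
          \<Prod>v\<in>set cs \<union> S. trans_rep j v ((?c \<circ> \<sigma>) v) (f v) (f ((?c \<circ> \<sigma>) v))) =
          (\<Sum>f\<in>set cs \<union> S \<rightarrow>\<^sub>E ?I. ?F f * ?G f)" by simp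
      also have "\<dots> = (\<Sum>f\<in>set cs \<rightarrow>\<^sub>E ?I. ?F f) * (\<Sum>f\<in>S \<rightarrow>\<^sub>E ?I. ?G f)"
      proof (rule sum_PiE_Un_mult)
        show "?F f = ?F g" if "\<And>y. y \<in> set cs \<Longrightarrow> f y = g y" for f g :: "'a \<Rightarrow> 'g \<times> nat"
          using that cperm by (intro prod.cong refl) (simp add: permutes_in_image)
        show "?G f = ?G g" if "\<And>y. y \<in> S \<Longrightarrow> f y = g y" for f g :: "'a \<Rightarrow> 'g \<times> nat"
          using that perm by (intro prod.cong refl) (simp add: permutes_in_image)
      qed (use comp.hyps(3) in auto)
      also have "(\<Sum>f\<in>set cs \<rightarrow>\<^sub>E ?I. ?F f) = (if zero_sum \<Gamma> w ?p then real (order \<Gamma> * j) - 1 else - 1)"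
        unfolding Cons by (rule sum_cycle_trans_rep[OF dist j adjc])
      finally have sum: "(\<Sum>f\<in>set cs \<union> S \<rightarrow>\<^sub>E ?I.
          \<Prod>v\<in>set cs \<union> S. trans_rep j v ((?c \<circ> \<sigma>) v) (f v) (f ((?c \<circ> \<sigma>) v))) =
          (if zero_sum \<Gamma> w ?p then real (order \<Gamma> * j) - 1 else - 1) * (\<Sum>f\<in>S \<rightarrow>\<^sub>E ?I. ?G f)" .
      have "sign (?c \<circ> \<sigma>) = sign ?c * sign \<sigma>"
        using perm finS by (intro sign_compose permutation_of_cycle permutes_imp_permutation)
      then have sgn: "real_of_int (sign (?c \<circ> \<sigma>)) = (-1) ^ length us * real_of_int (sign \<sigma>)"
        using sign_cycle_of_list[OF dist] Cons by simp
      have "card (set cs \<union> S) = card (set cs) + card S"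
        using finS comp.hyps(3) by (intro card_Un_disjoint) auto
      moreover have "card (set cs) = Suc (length us)"
        using distinct_card[OF dist] Cons by simp
      ultimately have card: "card (set cs \<union> S) = Suc (length us) + card S" by simp
      have "(if z then r - 1 else - 1) * G * ((-1) ^ l * s) =
          - ((if z then 1 - r else 1) * (-1) ^ l * (G * s))" for z and r G s :: real and l :: nat
        by (simp add: algebra_simps)
      then show ?thesis
        unfolding sum sgn card card_zs by (simp add: C(5)[OF j] power_add)
    qed
    show ?thesis
    proof (intro exI[of _ "insert ?p C"] conjI allI impI)
      show "pairwise (\<lambda>p q. disjnt (cycle_verts D p) (cycle_verts D q)) (insert ?p C)"
        using C(3) disj by (auto simp: pairwise_insert pv disjnt_sym)
      show "(\<Union>p\<in>insert ?p C. cycle_verts D p) = set cs \<union> S" using C(4) pv by auto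
      show "finite (insert ?p C)" using C(1) by simp
      show "\<forall>p\<in>insert ?p C. pre_digraph.cycle D p" using C(2) pcyc by blast
    qed (rule formula)
  qed
qed

end

section \<open>Counting zero-sum cycles\<close>

text \<open>Up to sign this is an \<open>m\<close>-th finite difference of a polynomial of degree at
  most \<open>t\<close>. Pascal's rule splits off one difference, which leaves powers below
  \<open>t\<close> and lowers \<open>m\<close> by one.\<close>

lemma alternating_binomial_sum_power:
  fixes b c :: "'a :: comm_ring_1"
  assumes "t < m"
  shows "(\<Sum>j\<le>m. (-1) ^ j * of_nat (m choose j) * (c + b * of_nat j) ^ t) = 0"
  using assms
proof (induction m arbitrary: c t)
  case (Suc m)
  let ?f = "\<lambda>j. (c + b * of_nat j) ^ t"
  have "(\<Sum>j\<le>Suc m. (-1) ^ j * of_nat (Suc m choose j) * ?f j) =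
      ?f 0 + (\<Sum>j\<le>m. (-1) ^ Suc j * of_nat (Suc m choose Suc j) * ?f (Suc j))"
    by (subst sum.atMost_Suc_shift) simp
  also have "(\<Sum>j\<le>m. (-1) ^ Suc j * of_nat (Suc m choose Suc j) * ?f (Suc j)) =
      (\<Sum>j\<le>m. (-1) ^ Suc j * of_nat (m choose Suc j) * ?f (Suc j)) -
      (\<Sum>j\<le>m. (-1) ^ j * of_nat (m choose j) * ?f (Suc j))"
    by (simp add: algebra_simps sum.distrib sum_negf sum_subtractf)
  also have "?f 0 + (\<dots>) = (\<Sum>j\<le>Suc m. (-1) ^ j * of_nat (m choose j) * ?f j) -
      (\<Sum>j\<le>m. (-1) ^ j * of_nat (m choose j) * ?f (Suc j))"
    by (subst sum.atMost_Suc_shift) simp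
  \<comment> \<open>The term \<open>j = Suc m\<close> vanishes because \<open>m choose Suc m\<close>
    is 0.\<close>
  also have "\<dots> = (\<Sum>j\<le>m. (-1) ^ j * of_nat (m choose j) * (?f j - ?f (Suc j)))"
    by (simp add: binomial_eq_0 right_diff_distrib sum_subtractf)
  also have "\<dots> = (\<Sum>j\<le>m. (-1) ^ j * of_nat (m choose j) *
      (- (\<Sum>s<t. of_nat (t choose s) * (c + b * of_nat j) ^ s * b ^ (t - s))))"
  proof (intro sum.cong refl arg_cong2[of _ _ _ _ "(*)"])
    fix j
    have "?f (Suc j) = ((c + b * of_nat j) + b) ^ t" by (simp add: algebra_simps)
    also have "\<dots> = (\<Sum>s\<le>t. of_nat (t choose s) * (c + b * of_nat j) ^ s * b ^ (t - s))"
      by (rule binomial_ring)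
    also have "\<dots> = (\<Sum>s<t. of_nat (t choose s) * (c + b * of_nat j) ^ s * b ^ (t - s)) + ?f j"
      by (simp add: lessThan_Suc_atMost[symmetric])
    finally show "?f j - ?f (Suc j) =
        - (\<Sum>s<t. of_nat (t choose s) * (c + b * of_nat j) ^ s * b ^ (t - s))" by simp
  qed
  also have "\<dots> = - (\<Sum>s<t. of_nat (t choose s) * b ^ (t - s) *
      (\<Sum>j\<le>m. (-1) ^ j * of_nat (m choose j) * (c + b * of_nat j) ^ s))"
    unfolding mult_minus_right sum_negf sum_distrib_left
    by (subst sum.swap) (simp add: mult_ac)
  also have "\<dots> = 0"
    using Suc by (simp add: sum.neutral)
  finally show ?case .
qed simp

text \<open>\<open>exp 1 < 2.72\<close> gives \<open>exp 1 ^ 3 \<le> 20.2\<close>, and Bernoulli's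
  inequality gives \<open>(25 / 20.2) ^ 50 > 4\<close>. This refutes the squared comparison in the
  final argument.\<close>

lemma power_25_gt:
  fixes m n :: nat
  assumes "m \<ge> 1" and "n \<ge> 50 * m"
  shows "4 ^ m * exp 1 ^ (3 * n) < (25 :: real) ^ n"
proof -
  have "exp 1 ^ 3 \<le> (2.72 :: real) ^ 3"
    using e_less_272 by (intro power_mono) auto
  then have e3: "exp 1 ^ 3 \<le> (20.2 :: real)" by (simp add: power3_eq_cube)
  have "4 < 1 + real 50 * (4.8 / 20.2)" by simp
  also have "\<dots> \<le> (1 + 4.8 / 20.2) ^ 50" by (rule Bernoulli_inequality) simp
  finally have b: "4 < (25 / 20.2 :: real) ^ 50" by simp
  have "4 ^ m < ((25 / 20.2 :: real) ^ 50) ^ m"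
    using b assms(1) by (intro power_strict_mono) auto
  also have "\<dots> = (25 / 20.2) ^ (50 * m)" by (simp only: power_mult)
  also have "\<dots> \<le> (25 / 20.2) ^ n" using assms(2) by (intro power_increasing) auto
  finally have "4 ^ m * 20.2 ^ n < (25 / 20.2 :: real) ^ n * 20.2 ^ n"
    by (intro mult_strict_right_mono) auto
  also have "\<dots> = (25 / 20.2 * 20.2) ^ n" by (simp only: power_mult_distrib)
  finally have "4 ^ m * 20.2 ^ n < (25 :: real) ^ n" by simp
  moreover have "exp 1 ^ (3 * n) \<le> (20.2 :: real) ^ n"
    unfolding power_mult using e3 by (intro power_mono) auto
  ultimately show ?thesis
    by (meson le_less_trans mult_left_mono zero_le_numeral zero_le_power)
qed

section \<open>Comparing the number of covers with its finite difference\<close>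

context labelled_digraph
begin

text \<open>Without parallel arcs, heads of outgoing and tails of incoming arcs are distinct, so
  degrees count neighbours.\<close>

lemma sum_adj:
  assumes "regular_digraph d D" and "v \<in> verts D"
  shows "(\<Sum>u\<in>verts D. of_bool (adj v u)) = real d"
    and "(\<Sum>u\<in>verts D. of_bool (adj u v)) = real d"
proof -
  have "bij_betw (head D) (out_arcs D v) {u \<in> verts D. adj v u}"
    unfolding bij_betw_def inj_on_def adj_def using no_multi_arcs
    by (auto simp: arc_to_ends_def)
  then have "card {u \<in> verts D. adj v u} = d"
    using assms bij_betw_same_card by (fastforce simp: regular_digraph_def out_degree_def)
  then show "(\<Sum>u\<in>verts D. of_bool (adj v u)) = real d"
    by (simp add: of_bool_def sum.If_cases Int_def)
  have "bij_betw (tail D) (in_arcs D v) {u \<in> verts D. adj u v}"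
    unfolding bij_betw_def inj_on_def adj_def using no_multi_arcs
    by (auto simp: arc_to_ends_def)
  then have "card {u \<in> verts D. adj u v} = d"
    using assms bij_betw_same_card by (fastforce simp: regular_digraph_def in_degree_def)
  then show "(\<Sum>u\<in>verts D. of_bool (adj u v)) = real d"
    by (simp add: of_bool_def sum.If_cases Int_def)
qed

lemma regular_card_verts_ge:
  assumes "regular_digraph d D" and "verts D \<noteq> {}"
  shows "d \<le> card (verts D)"
proof -
  obtain v where "v \<in> verts D" using assms by auto
  then have "real d = (\<Sum>u\<in>verts D. of_bool (adj v u))" using sum_adj assms by simp
  also have "\<dots> \<le> (\<Sum>u\<in>verts D. 1)" by (intro sum_mono) auto
  finally show ?thesis by simp
qed

definition covers :: "('a \<Rightarrow> 'a) set" where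
  "covers = {\<sigma>. \<sigma> permutes verts D \<and> (\<forall>v\<in>verts D. adj v (\<sigma> v))}"

lemma prod_adj: "(\<Prod>v\<in>verts D. of_bool (adj v (\<sigma> v))) = (of_bool (\<forall>v\<in>verts D. adj v (\<sigma> v)) :: real)"
  by (auto intro!: prod.neutral prod_zero)

lemma sum_over_covers:
  "(\<Sum>\<sigma> | \<sigma> permutes verts D. (\<Prod>v\<in>verts D. of_bool (adj v (\<sigma> v))) * F \<sigma>) = (\<Sum>\<sigma>\<in>covers. F \<sigma> :: real)"
  unfolding covers_def prod_adj
  by (rule sum.mono_neutral_cong_right) (auto simp: finite_permutations)

text \<open>The count is the permanent of the adjacency matrix, whose row and column sums are
  \<open>d\<close>.\<close>

lemma card_covers_ge:
  assumes "regular_digraph d D" and "d \<ge> 1"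
  shows "(real d / exp 1) ^ card (verts D) \<le> real (card covers)"
proof -
  have "(real d / exp 1) ^ card (verts D) \<le>
      (\<Sum>\<sigma> | \<sigma> permutes verts D. \<Prod>v\<in>verts D. of_bool (adj v (\<sigma> v)))"
    using assms sum_adj[OF assms(1)] by (intro permanent_regular_ge) auto
  then show ?thesis using sum_over_covers[of "\<lambda>_. 1"] by simp
qed

lemma signed_cover_sum_le:
  assumes reg: "regular_digraph d D" and "d \<ge> 1" and "j \<ge> 1"
    and T: "\<And>\<sigma>. \<sigma> \<in> covers \<Longrightarrow>
      (\<Sum>f\<in>verts D \<rightarrow>\<^sub>E reg_index \<Gamma> j. \<Prod>v\<in>verts D. trans_rep j v (\<sigma> v) (f v) (f (\<sigma> v))) * of_int (sign \<sigma>) =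
      (-1) ^ card (verts D) * (1 - real (order \<Gamma> * j)) ^ T \<sigma>"
  shows "(\<Sum>\<sigma>\<in>covers. (1 - real (order \<Gamma> * j)) ^ T \<sigma>)\<^sup>2 \<le>
    (exp 1 * real d * real (order \<Gamma> * j)) ^ card (verts D)"
proof -
  let ?V = "verts D" and ?I = "reg_index \<Gamma> j"
  \<comment> \<open>A block matrix indexed by vertices and states: the block of an arc represents
    its label, and all other blocks are zero.\<close>
  define B where "B x y = of_bool (adj (fst x) (fst y)) * trans_rep j (fst x) (fst y) (snd x) (snd y)"
    for x y
  have "order \<Gamma> > 0" using finite_group \<Gamma>.order_gt_0_iff_finite by simp
  then have N: "order \<Gamma> * j \<ge> 1" using \<open>j \<ge> 1\<close> by simp
  have "(\<Sum>f\<in>?V \<rightarrow>\<^sub>E ?I. \<Sum>\<sigma> | \<sigma> permutes ?V. of_int (sign \<sigma>) * (\<Prod>v\<in>?V. B (v, f v) (\<sigma> v, f (\<sigma> v)))) =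
      (\<Sum>\<sigma> | \<sigma> permutes ?V. (\<Prod>v\<in>?V. of_bool (adj v (\<sigma> v))) *
        ((\<Sum>f\<in>?V \<rightarrow>\<^sub>E ?I. \<Prod>v\<in>?V. trans_rep j v (\<sigma> v) (f v) (f (\<sigma> v))) * of_int (sign \<sigma>)))"
    by (subst sum.swap) (simp add: B_def prod.distrib sum_distrib_left sum_distrib_right mult_ac)
  also have "\<dots> = (\<Sum>\<sigma>\<in>covers. (\<Sum>f\<in>?V \<rightarrow>\<^sub>E ?I. \<Prod>v\<in>?V. trans_rep j v (\<sigma> v) (f v) (f (\<sigma> v))) * of_int (sign \<sigma>))"
    by (rule sum_over_covers)
  also have "\<dots> = (-1) ^ card ?V * (\<Sum>\<sigma>\<in>covers. (1 - real (order \<Gamma> * j)) ^ T \<sigma>)"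
    by (simp add: T sum_distrib_left)
  finally have "(\<Sum>\<sigma>\<in>covers. (1 - real (order \<Gamma> * j)) ^ T \<sigma>)\<^sup>2 =
      (\<Sum>f\<in>?V \<rightarrow>\<^sub>E ?I. \<Sum>\<sigma> | \<sigma> permutes ?V. of_int (sign \<sigma>) * (\<Prod>v\<in>?V. B (v, f v) (\<sigma> v, f (\<sigma> v))))\<^sup>2"
    by (simp add: power_mult_distrib flip: power_mult)
  also have "\<dots> \<le> (exp 1 * real d * real (order \<Gamma> * j)) ^ card ?V"
  proof (rule transversal_minor_sum_le)
    show "finite ?I" using finite_group by (rule finite_reg_index)
    show "card ?I = order \<Gamma> * j" by (rule card_reg_index)
    show "B x x = 0" for x using not_adj_self by (simp add: B_def)
    fix x assume x: "x \<in> ?V \<times> ?I"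
    obtain v i where vi: "x = (v, i)" "v \<in> ?V" "i \<in> ?I" using x by auto
    have "(\<Sum>y\<in>?V \<times> ?I. (B x y)\<^sup>2) =
        (\<Sum>u\<in>?V. of_bool (adj v u) * (\<Sum>i'\<in>?I. (trans_rep j v u i i')\<^sup>2))"
    proof -
      have "(of_bool P * r)\<^sup>2 = of_bool P * r\<^sup>2" for P and r :: real by simp
      then show ?thesis
        unfolding vi(1) by (simp add: B_def sum.cartesian_product' sum_distrib_left)
    qed
    \<comment> \<open>Each out-neighbour contributes one row of its block, of squared norm at most
      1.\<close>
    also have "\<dots> \<le> (\<Sum>u\<in>?V. of_bool (adj v u))"
    proof (rule sum_mono)
      fix u
      show "of_bool (adj v u) * (\<Sum>i'\<in>?I. (trans_rep j v u i i')\<^sup>2) \<le> (of_bool (adj v u) :: real)"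
        using \<Gamma>.reg_rep_row_square[OF finite_group label_arc_between vi(3)]
        by (simp add: trans_rep_def of_bool_def)
    qed
    also have "\<dots> = real d" using sum_adj(1)[OF reg vi(2)] .
    finally show "(\<Sum>y\<in>?V \<times> ?I. (B x y)\<^sup>2) \<le> real d" .
  qed (use N \<open>d \<ge> 1\<close> in auto)
  finally show ?thesis .
qed

theorem regular_cycle_cover_zero_sum:
  assumes reg: "regular_digraph d D" and "d \<ge> 1" and "verts D \<noteq> {}" and k: "order \<Gamma> \<ge> 2"
  shows "\<exists>C. directed_cycle_cover D C \<and>
    int (card {p \<in> C. zero_sum \<Gamma> w p}) \<ge> \<lfloor>real d / (25 * real (order \<Gamma>))\<rfloor>"
proof -
  let ?k = "order \<Gamma>" and ?n = "card (verts D)"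
  define m where "m = nat \<lfloor>real d / (25 * real ?k)\<rfloor>"
  have m_eq: "int m = \<lfloor>real d / (25 * real ?k)\<rfloor>" by (simp add: m_def)
  then have "real m \<le> real d / (25 * real ?k)" by linarith
  then have md: "real m * (25 * real ?k) \<le> real d"
    using k by (simp add: pos_le_divide_eq)
  \<comment> \<open>The same cover must satisfy the identity for every \<open>j\<close>, since its
    number of zero-sum cycles is the exponent at all evaluation points.\<close>
  define good where "good \<sigma> C \<longleftrightarrow> directed_cycle_cover D C \<and> (\<forall>j\<ge>1.
      (\<Sum>f\<in>verts D \<rightarrow>\<^sub>E reg_index \<Gamma> j. \<Prod>v\<in>verts D. trans_rep j v (\<sigma> v) (f v) (f (\<sigma> v))) * of_int (sign \<sigma>) =
      (-1) ^ ?n * (1 - real (?k * j)) ^ card {p \<in> C. zero_sum \<Gamma> w p})" for \<sigma> C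
  have "\<exists>C. good \<sigma> C" if "\<sigma> \<in> covers" for \<sigma>
  proof -
    have "cycle_decomp (verts D) \<sigma>"
      using that by (intro cycle_decomposition) (auto simp: covers_def)
    from permutation_cycle_cover[OF this] show ?thesis
      using that unfolding good_def directed_cycle_cover_def covers_def by auto
  qed
  then obtain cov where cov: "\<And>\<sigma>. \<sigma> \<in> covers \<Longrightarrow> good \<sigma> (cov \<sigma>)" by metis
  define T where "T \<sigma> = card {p \<in> cov \<sigma>. zero_sum \<Gamma> w p}" for \<sigma>
  define q where "q j = (\<Sum>\<sigma>\<in>covers. (1 - real (?k * j)) ^ T \<sigma>)" for j
  have card_pos: "real (card covers) > 0"
  proof -
    have "0 < (real d / exp 1) ^ ?n" using \<open>d \<ge> 1\<close> by simp
    then show ?thesis using card_covers_ge[OF reg \<open>d \<ge> 1\<close>] by linarith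
  qed
  have "\<exists>\<sigma>\<in>covers. T \<sigma> \<ge> m"
  proof (rule ccontr)
    assume "\<not> (\<exists>\<sigma>\<in>covers. T \<sigma> \<ge> m)"
    then have less: "T \<sigma> < m" if "\<sigma> \<in> covers" for \<sigma> using that by auto
    \<comment> \<open>Some cover exists and its count is a natural number below \<open>m\<close>, so
      \<open>m\<close> is positive.\<close>
    have "covers \<noteq> {}" using card_pos by auto
    then have "m \<ge> 1" using less by fastforce
    define \<beta> where "\<beta> = sqrt ((exp 1 * (real d)\<^sup>2 / 25) ^ ?n)"
    have q_le: "\<bar>q j\<bar> \<le> \<beta>" if j: "1 \<le> j" "j \<le> m" for j
    proof -
      have "(q j)\<^sup>2 \<le> (exp 1 * real d * real (?k * j)) ^ ?n"
        unfolding q_def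
        by (rule signed_cover_sum_le[OF reg \<open>d \<ge> 1\<close> j(1)]) (use cov j in \<open>auto simp: good_def T_def\<close>)
      also have "\<dots> \<le> (exp 1 * real d * (real d / 25)) ^ ?n"
      proof (intro power_mono mult_left_mono)
        \<comment> \<open>This is where the constant 25 enters: \<open>?k * j\<close> is at most
          \<open>?k * m\<close>, hence at most \<open>d / 25\<close>.\<close>
        have "real ?k * real j \<le> real ?k * real m" using j by (intro mult_left_mono) auto
        then show "real (?k * j) \<le> real d / 25" using md by (simp add: algebra_simps)
      qed auto
      also have "\<dots> = (exp 1 * (real d)\<^sup>2 / 25) ^ ?n" by (simp add: power2_eq_square mult.assoc)
      finally show ?thesis unfolding \<beta>_def by (intro real_le_rsqrt) simp
    qed
    \<comment> \<open>Each cover contributes a power of \<open>1 - ?k * j\<close> with exponent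
      below \<open>m\<close>, which the \<open>m\<close>-th difference annihilates.\<close>
    have "(\<Sum>j\<le>m. (-1) ^ j * real (m choose j) * q j) =
        (\<Sum>\<sigma>\<in>covers. \<Sum>j\<le>m. (-1) ^ j * real (m choose j) * (1 + (- real ?k) * real j) ^ T \<sigma>)"
      unfolding q_def sum_distrib_left by (subst sum.swap) simp
    also have "\<dots> = 0"
      using less by (intro sum.neutral ballI alternating_binomial_sum_power)
    finally have zero: "(\<Sum>j\<le>m. (-1) ^ j * real (m choose j) * q j) = 0" .
    \<comment> \<open>The term \<open>j = 0\<close> counts the covers, so the remaining terms must
      balance that number.\<close>
    have "q 0 = real (card covers)" by (simp add: q_def)
    moreover have split: "{..m} = insert 0 {1..m}" by auto
    ultimately have "real (card covers) = - (\<Sum>j=1..m. (-1) ^ j * real (m choose j) * q j)"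
      using zero unfolding split by simp
    also have "\<dots> \<le> \<bar>\<Sum>j=1..m. (-1) ^ j * real (m choose j) * q j\<bar>" by simp
    also have "\<dots> \<le> (\<Sum>j=1..m. \<bar>(-1) ^ j * real (m choose j) * q j\<bar>)" by (rule sum_abs)
    also have "\<dots> \<le> (\<Sum>j=1..m. real (m choose j) * \<beta>)"
      using q_le by (intro sum_mono) (auto simp: abs_mult intro!: mult_left_mono)
    \<comment> \<open>Restoring the nonnegative term \<open>j = 0\<close> completes the binomial row
      sum \<open>2 ^ m\<close>.\<close>
    also have "\<dots> \<le> (\<Sum>j\<le>m. real (m choose j) * \<beta>)"
      by (intro sum_mono2) (auto simp: \<beta>_def)
    also have "\<dots> = 2 ^ m * \<beta>"
      using choose_row_sum[of m] by (simp flip: sum_distrib_right of_nat_sum)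
    finally have "(real d / exp 1) ^ ?n \<le> 2 ^ m * \<beta>"
      using card_covers_ge[OF reg \<open>d \<ge> 1\<close>] by linarith
    \<comment> \<open>Squaring removes the root in \<open>\<beta>\<close>; cancelling the powers of
      \<open>d\<close> then leaves \<open>25 ^ ?n\<close> against
      \<open>4 ^ m * exp 1 ^ (3 * ?n)\<close>.\<close>
    then have "((real d / exp 1) ^ ?n)\<^sup>2 \<le> (2 ^ m * \<beta>)\<^sup>2"
      by (intro power_mono) auto
    also have "(2 ^ m * \<beta>)\<^sup>2 = 4 ^ m * (exp 1 * (real d)\<^sup>2 / 25) ^ ?n"
    proof -
      have "((2 :: real) ^ m)\<^sup>2 = (2\<^sup>2) ^ m" by (simp only: power_mult[symmetric] mult.commute)
      moreover have "\<beta>\<^sup>2 = (exp 1 * (real d)\<^sup>2 / 25) ^ ?n" by (simp add: \<beta>_def)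
      ultimately show ?thesis by (simp add: power_mult_distrib)
    qed
    finally have "(real d ^ ?n)\<^sup>2 * 25 ^ ?n \<le> (real d ^ ?n)\<^sup>2 * (4 ^ m * exp 1 ^ (3 * ?n))"
      by (simp add: power_divide power_mult_distrib field_simps power_mult power2_eq_square power3_eq_cube)
    then have "25 ^ ?n \<le> 4 ^ m * (exp 1 :: real) ^ (3 * ?n)"
      using \<open>d \<ge> 1\<close> by (subst (asm) mult_le_cancel_left_pos) auto
    \<comment> \<open>Order at least 2 turns \<open>25 * ?k * m \<le> d\<close> into
      \<open>50 * m \<le> d\<close>, and there are at least \<open>d\<close> vertices.\<close>
    moreover have "?n \<ge> 50 * m"
    proof -
      have "real m * 50 \<le> real m * (25 * real ?k)" using k by (intro mult_left_mono) auto
      then have "50 * m \<le> d" using md by linarith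
      then show ?thesis using regular_card_verts_ge[OF reg assms(3)] by linarith
    qed
    ultimately show False using power_25_gt[OF \<open>m \<ge> 1\<close>, of ?n] by linarith
  qed
  then obtain \<sigma> where "\<sigma> \<in> covers" "m \<le> T \<sigma>" by blast
  then show ?thesis
    using cov[of \<sigma>] m_eq by (intro exI[of _ "cov \<sigma>"]) (auto simp: good_def T_def)
qed

end

theorem theorem4p1:
  fixes \<Gamma> :: "('g, 'm) monoid_scheme"
    and D :: "('a, 'b) pre_digraph"
    and w :: "'b \<Rightarrow> 'g"
    and k d :: nat
  assumes "group \<Gamma>"
    and "finite (carrier \<Gamma>)"
    and "order \<Gamma> = k"
    and "k \<ge> 2"
    and "d \<ge> 1"
    and "digraph D"
    and "verts D \<noteq> {}"
    and "regular_digraph d D"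
    and "w \<in> arcs D \<rightarrow> carrier \<Gamma>"
  shows "\<exists>C. directed_cycle_cover D C \<and>
    int (card {p \<in> C. zero_sum \<Gamma> w p}) \<ge> \<lfloor>real d / (25 * real k)\<rfloor>"
proof -
  interpret labelled_digraph D \<Gamma> w
    using assms by (intro labelled_digraph.intro labelled_digraph_axioms.intro)
  show ?thesis
    using regular_cycle_cover_zero_sum assms by simp
qed

end
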